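(* Let $X$ be a real analytic orbifold. If $\tau_1\colon|K_1|\to X$ and $\tau_2\colon|K_2|\to X$ are two subanalytic triangulations of $X$, then $\tau_1^{-1}\circ\tau_2\colon|K_2|\to|K_1|$ is a subanalytic homeomorphism.
   Context: Orbifolds. Let $X$ be a topological space and $n>0$. An $n$-dimensional orbifold chart for an open subset $V\subset X$ is a triple $(\tilde V,G,\varphi)$ where $\tilde V$ is a connected open subset of $\mathbb{R}^n$, $G$ is a finite group acting on $\tilde V$ by homeomorphisms (not necessarily effectively; $\ker(G)$ denotes the subgroup acting trivially), and $\varphi\colon\tilde V\to V$ is a $G$-invariant map inducing a homeomorphism $\tilde V/G\to V$. If $V_i\subset V_j$, an embedding $(\lambda_{ij},h_{ij})\colon(\tilde V_i,G_i,\varphi_i)\to(\tilde V_j,G_j,\varphi_j)$ consists of an injective homomorphism $h_{ij}\colon G_i\to G_j$ restricting to an isomorphism $\ker(G_i)\to\ker(G_j)$ and an embedding $\lambda_{ij}\colon\tilde V_i\to\tilde V_j$ with $\lambda_{ij}(gx)=h_{ij}(g)\lambda_{ij}(x)$ and $\varphi_j\circ\lambda_{ij}=\varphi_i$. An orbifold atlas on $X$ is a family of charts whose images $V_i$ cover $X$ and such that for any two charts with images $V_i,V_j$ and any $x\in V_i\cap V_j$ there is a chart with image $V_k$, $x\in V_k\subset V_i\cap V_j$, that embeds into both charts. An atlas refines another if each of its charts embeds into some chart of the other; two atlases are equivalent if they have a common refinement. An $n$-dimensional orbifold is a paracompact Hausdorff space with an equivalence class of $n$-dimensional orbifold atlases.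 All orbifolds are assumed to have only countably many connected components (hence are second countable). The orbifold is real analytic ($C^\omega$) if all groups $G_i$ act by real analytic diffeomorphisms and all $\lambda_{ij}$ are real analytic embeddings. Subanalytic maps. A map between real analytic manifolds (or between subanalytic subsets of them) is subanalytic if it is continuous and its graph is a subanalytic subset of the product manifold. A map $f\colon X\to Y$ of real analytic orbifolds is subanalytic if for every $x\in X$ there are (real analytic) orbifold charts $(\tilde U,G,\varphi)$ of $X$ and $(\tilde V,H,\psi)$ of $Y$ with $x\in U=\varphi(\tilde U)$, $f(x)\in V=\psi(\tilde V)$, a homomorphism $\theta\colon G\to H$ and a $\theta$-equivariant subanalytic map $\tilde f\colon\tilde U\to\tilde V$ with $\psi\circ\tilde f=f\circ\varphi$. $\mathbb{R}^m$ is regarded as an orbifold with trivial groups. A subanalytic homeomorphism is a subanalytic bijection whose inverse is subanalytic. Triangulations. A subanalytic triangulation of $X$ is a pair of a simplicial complex $K$ and a homeomorphism $\tau\colon|K|\to X$ ($|K|$ being the space of $K$) such that $\tau^{-1}\colon X\to|K|$ is subanalytic. Here $K$ is countable and locally finite and $|K|$ admits a linear embedding $e$ as a closed subset of some $\mathbb{R}^m$; the image $e(|K|)$ is subanalytic in $\mathbb{R}^m$ and $|K|$ carries the subanalytic structure induced by such an embedding (independent of the choice). Thus a map $g\colon X\to|K|$ is subanalytic if $e\circ g\colon X\to\mathbb{R}^m$ is subanalytic, and a map $|K_2|\to|K_1|$ is subanalytic if the corresponding map $e_2(|K_2|)\to e_1(|K_1|)$ is subanalytic. *)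

theory Defs
  imports "HOL-Analysis.Analysis" "HOL-Algebra.Group_Action"
begin

section \<open>Coordinates\<close>

text \<open>
  The dimensions of the Euclidean spaces below are existentially quantified (in the definition of
  subanalytic sets, and for embeddings of simplicial complexes), so \<open>\<real>\<^sup>n\<close> is the library space
  \<^const>\<open>Euclidean_space\<close>, whose points are the functions \<open>nat \<Rightarrow> real\<close> vanishing from index
  \<open>n\<close> on. The product of \<open>\<real>\<^sup>n\<close> and \<open>\<real>\<^sup>m\<close> is \<open>\<real>\<^sup>n\<^sup>+\<^sup>m\<close>, by concatenation of coordinates.
\<close>

definition vec_append :: "nat \<Rightarrow> (nat \<Rightarrow> real) \<Rightarrow> (nat \<Rightarrow> real) \<Rightarrow> nat \<Rightarrow> real" where
  "vec_append n x y = (\<lambda>i. if i < n then x i else y (i - n))"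

definition vec_take :: "nat \<Rightarrow> (nat \<Rightarrow> real) \<Rightarrow> nat \<Rightarrow> real" where
  "vec_take n x = (\<lambda>i. if i < n then x i else 0)"

definition vec_Times :: "nat \<Rightarrow> (nat \<Rightarrow> real) set \<Rightarrow> (nat \<Rightarrow> real) set \<Rightarrow> (nat \<Rightarrow> real) set" where
  "vec_Times n A B = {vec_append n x y | x y. x \<in> A \<and> y \<in> B}"

abbreviation subspace_of :: "nat \<Rightarrow> (nat \<Rightarrow> real) set \<Rightarrow> (nat \<Rightarrow> real) topology" where
  "subspace_of n A \<equiv> subtopology (Euclidean_space n) A"


section \<open>Real analytic maps\<close>

definition multi_indices :: "nat \<Rightarrow> (nat \<Rightarrow> nat) set" where
  "multi_indices n = {\<alpha>. \<forall>i\<ge>n. \<alpha> i = 0}"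

definition real_analytic_fun :: "nat \<Rightarrow> (nat \<Rightarrow> real) set \<Rightarrow> ((nat \<Rightarrow> real) \<Rightarrow> real) \<Rightarrow> bool" where
  "real_analytic_fun n U f \<longleftrightarrow>
     (\<forall>a\<in>U. \<exists>(c :: (nat \<Rightarrow> nat) \<Rightarrow> real) r. 0 < r \<and>
        (\<forall>x\<in>U. (\<forall>i<n. \<bar>x i - a i\<bar> < r) \<longrightarrow>
           ((\<lambda>\<alpha>. c \<alpha> * (\<Prod>i<n. (x i - a i) ^ \<alpha> i)) has_sum f x) (multi_indices n)))"

definition real_analytic_map ::
    "nat \<Rightarrow> nat \<Rightarrow> (nat \<Rightarrow> real) set \<Rightarrow> ((nat \<Rightarrow> real) \<Rightarrow> nat \<Rightarrow> real) \<Rightarrow> bool" where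
  "real_analytic_map n m U f \<longleftrightarrow>
     f ` U \<subseteq> topspace (Euclidean_space m) \<and> (\<forall>i<m. real_analytic_fun n U (\<lambda>x. f x i))"

definition real_analytic_diffeo ::
    "nat \<Rightarrow> (nat \<Rightarrow> real) set \<Rightarrow> (nat \<Rightarrow> real) set \<Rightarrow> ((nat \<Rightarrow> real) \<Rightarrow> nat \<Rightarrow> real) \<Rightarrow> bool" where
  "real_analytic_diffeo n U V f \<longleftrightarrow>
     bij_betw f U V \<and> real_analytic_map n n U f \<and> real_analytic_map n n V (inv_into U f)"

text \<open>
  Between open subsets of \<open>\<real>\<^sup>n\<close> a real analytic embedding is a real analytic diffeomorphism onto
  an \<open>n\<close>-dimensional submanifold, that is, onto an open set.
\<close>

definition real_analytic_embedding ::
    "nat \<Rightarrow> (nat \<Rightarrow> real) set \<Rightarrow> (nat \<Rightarrow> real) set \<Rightarrow> ((nat \<Rightarrow> real) \<Rightarrow> nat \<Rightarrow> real) \<Rightarrow> bool" where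
  "real_analytic_embedding n U V f \<longleftrightarrow>
     f ` U \<subseteq> V \<and> openin (Euclidean_space n) (f ` U) \<and> real_analytic_diffeo n U (f ` U) f"


section \<open>Semianalytic and subanalytic sets\<close>

text \<open>Here \<open>M\<close> is an open subset of \<open>\<real>\<^sup>n\<close>, regarded as a real analytic manifold.\<close>

definition semianalytic_in :: "nat \<Rightarrow> (nat \<Rightarrow> real) set \<Rightarrow> (nat \<Rightarrow> real) set \<Rightarrow> bool" where
  "semianalytic_in n M A \<longleftrightarrow> A \<subseteq> M \<and>
     (\<forall>a\<in>M. \<exists>U \<F>. openin (subspace_of n M) U \<and> a \<in> U \<and> finite \<F> \<and>
        (\<forall>(P, Z)\<in>\<F>. finite P \<and> finite Z \<and> (\<forall>f\<in>P \<union> Z. real_analytic_fun n U f)) \<and>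
        A \<inter> U = (\<Union>(P, Z)\<in>\<F>. {x\<in>U. (\<forall>f\<in>P. f x > 0) \<and> (\<forall>f\<in>Z. f x = 0)}))"

text \<open>
  Subanalytic sets are those that are locally projections to \<open>M\<close> of relatively compact
  semianalytic subsets of some \<open>M \<times> \<real>\<^sup>p\<close>.
\<close>

definition subanalytic_in :: "nat \<Rightarrow> (nat \<Rightarrow> real) set \<Rightarrow> (nat \<Rightarrow> real) set \<Rightarrow> bool" where
  "subanalytic_in n M A \<longleftrightarrow> A \<subseteq> M \<and>
     (\<forall>a\<in>M. \<exists>U p B. openin (subspace_of n M) U \<and> a \<in> U \<and>
        (let N = vec_Times n M (topspace (Euclidean_space p)); T = subspace_of (n + p) N in
           semianalytic_in (n + p) N B \<and> compactin T (T closure_of B)) \<and>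
        A \<inter> U = vec_take n ` B)"

text \<open>
  \<open>subanalytic_map n M A m N B f\<close>: the map \<open>f : A \<rightarrow> B\<close> between subsets of the open sets
  \<open>M \<subseteq> \<real>\<^sup>n\<close> and \<open>N \<subseteq> \<real>\<^sup>m\<close> is continuous with graph subanalytic in \<open>M \<times> N\<close>.
\<close>

definition subanalytic_map ::
    "nat \<Rightarrow> (nat \<Rightarrow> real) set \<Rightarrow> (nat \<Rightarrow> real) set \<Rightarrow>
     nat \<Rightarrow> (nat \<Rightarrow> real) set \<Rightarrow> (nat \<Rightarrow> real) set \<Rightarrow> ((nat \<Rightarrow> real) \<Rightarrow> nat \<Rightarrow> real) \<Rightarrow> bool" where
  "subanalytic_map n M A m N B f \<longleftrightarrow>
     continuous_map (subspace_of n A) (subspace_of m B) f \<and>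
     subanalytic_in (n + m) (vec_Times n M N) {vec_append n x (f x) | x. x \<in> A}"


section \<open>Orbifolds\<close>

record ('g, 'a) orbifold_chart =
  chart_dom :: "(nat \<Rightarrow> real) set"
  chart_group :: "'g monoid"
  chart_act :: "'g \<Rightarrow> (nat \<Rightarrow> real) \<Rightarrow> nat \<Rightarrow> real"
  chart_map :: "(nat \<Rightarrow> real) \<Rightarrow> 'a"

definition chart_image :: "('g, 'a) orbifold_chart \<Rightarrow> 'a set" where
  "chart_image c = chart_map c ` chart_dom c"

definition chart_kernel :: "('g, 'a) orbifold_chart \<Rightarrow> 'g set" where
  "chart_kernel c = {g \<in> carrier (chart_group c). \<forall>u\<in>chart_dom c. chart_act c g u = u}"

text \<open>
  That \<open>chart_map\<close> induces a homeomorphism from the orbit space onto the image is expressed by its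
  being a quotient map whose fibres are the orbits.
\<close>

definition orbifold_chart :: "nat \<Rightarrow> 'a topology \<Rightarrow> ('g, 'a) orbifold_chart \<Rightarrow> bool" where
  "orbifold_chart n X c \<longleftrightarrow>
     openin (Euclidean_space n) (chart_dom c) \<and>
     connectedin (Euclidean_space n) (chart_dom c) \<and>
     finite (carrier (chart_group c)) \<and>
     group_action (chart_group c) (chart_dom c) (chart_act c) \<and>
     (\<forall>g\<in>carrier (chart_group c).
        homeomorphic_map (subspace_of n (chart_dom c)) (subspace_of n (chart_dom c)) (chart_act c g)) \<and>
     openin X (chart_image c) \<and>
     quotient_map (subspace_of n (chart_dom c)) (subtopology X (chart_image c)) (chart_map c) \<and>
     (\<forall>u\<in>chart_dom c. \<forall>v\<in>chart_dom c.
        chart_map c u = chart_map c v \<longleftrightarrow> v \<in> orbit (chart_group c) (chart_act c) u)"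

definition chart_embedding ::
    "nat \<Rightarrow> ('g, 'a) orbifold_chart \<Rightarrow> ('g, 'a) orbifold_chart \<Rightarrow>
     ((nat \<Rightarrow> real) \<Rightarrow> nat \<Rightarrow> real) \<Rightarrow> ('g \<Rightarrow> 'g) \<Rightarrow> bool" where
  "chart_embedding n c d l h \<longleftrightarrow>
     h \<in> hom (chart_group c) (chart_group d) \<and>
     inj_on h (carrier (chart_group c)) \<and>
     bij_betw h (chart_kernel c) (chart_kernel d) \<and>
     embedding_map (subspace_of n (chart_dom c)) (subspace_of n (chart_dom d)) l \<and>
     (\<forall>g\<in>carrier (chart_group c). \<forall>u\<in>chart_dom c. l (chart_act c g u) = chart_act d (h g) (l u)) \<and>
     (\<forall>u\<in>chart_dom c. chart_map d (l u) = chart_map c u)"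

definition analytic_chart :: "nat \<Rightarrow> 'a topology \<Rightarrow> ('g, 'a) orbifold_chart \<Rightarrow> bool" where
  "analytic_chart n X c \<longleftrightarrow> orbifold_chart n X c \<and>
     (\<forall>g\<in>carrier (chart_group c). real_analytic_diffeo n (chart_dom c) (chart_dom c) (chart_act c g))"

definition embeds_analytically ::
    "nat \<Rightarrow> ('g, 'a) orbifold_chart \<Rightarrow> ('g, 'a) orbifold_chart \<Rightarrow> bool" where
  "embeds_analytically n c d \<longleftrightarrow>
     (\<exists>l h. chart_embedding n c d l h \<and> real_analytic_embedding n (chart_dom c) (chart_dom d) l)"

definition analytic_atlas :: "nat \<Rightarrow> 'a topology \<Rightarrow> ('g, 'a) orbifold_chart set \<Rightarrow> bool" where
  "analytic_atlas n X \<A> \<longleftrightarrow>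
     (\<forall>c\<in>\<A>. analytic_chart n X c) \<and>
     (\<Union>c\<in>\<A>. chart_image c) = topspace X \<and>
     (\<forall>c\<in>\<A>. \<forall>d\<in>\<A>. \<forall>x \<in> chart_image c \<inter> chart_image d.
        \<exists>b\<in>\<A>. x \<in> chart_image b \<and> chart_image b \<subseteq> chart_image c \<inter> chart_image d \<and>
               embeds_analytically n b c \<and> embeds_analytically n b d)"

definition atlas_refines ::
    "nat \<Rightarrow> ('g, 'a) orbifold_chart set \<Rightarrow> ('g, 'a) orbifold_chart set \<Rightarrow> bool" where
  "atlas_refines n \<B> \<A> \<longleftrightarrow> (\<forall>b\<in>\<B>. \<exists>c\<in>\<A>. embeds_analytically n b c)"

definition atlas_equivalent ::
    "nat \<Rightarrow> 'a topology \<Rightarrow> ('g, 'a) orbifold_chart set \<Rightarrow> ('g, 'a) orbifold_chart set \<Rightarrow> bool" where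
  "atlas_equivalent n X \<A> \<B> \<longleftrightarrow>
     (\<exists>\<C>. analytic_atlas n X \<C> \<and> atlas_refines n \<C> \<A> \<and> atlas_refines n \<C> \<B>)"

definition atlas_class ::
    "nat \<Rightarrow> 'a topology \<Rightarrow> ('g, 'a) orbifold_chart set \<Rightarrow> ('g, 'a) orbifold_chart set set" where
  "atlas_class n X \<A> = {\<B>. analytic_atlas n X \<B> \<and> atlas_equivalent n X \<A> \<B>}"

definition paracompact_space :: "'a topology \<Rightarrow> bool" where
  "paracompact_space X \<longleftrightarrow>
     (\<forall>\<U>. (\<forall>U\<in>\<U>. openin X U) \<and> \<Union>\<U> = topspace X \<longrightarrow>
        (\<exists>\<V>. (\<forall>V\<in>\<V>. openin X V \<and> (\<exists>U\<in>\<U>. V \<subseteq> U)) \<and> \<Union>\<V> = topspace X \<and> locally_finite_in X \<V>))"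

text \<open>
  A real analytic orbifold is a space \<open>X\<close> with an equivalence class \<open>\<OO>\<close> of atlases. The charts
  of the orbifold are the elements of \<open>\<Union>\<OO>\<close>.
\<close>

definition real_analytic_orbifold ::
    "nat \<Rightarrow> 'a topology \<Rightarrow> ('g, 'a) orbifold_chart set set \<Rightarrow> bool" where
  "real_analytic_orbifold n X \<OO> \<longleftrightarrow>
     0 < n \<and> paracompact_space X \<and> Hausdorff_space X \<and> countable (connected_components_of X) \<and>
     (\<exists>\<A>. analytic_atlas n X \<A> \<and> \<OO> = atlas_class n X \<A>)"

text \<open>
  The orbifold \<open>\<real>\<^sup>m\<close>: the type \<open>unit\<close> forces all chart groups in its class to be trivial. Actions are
  extensional functions in \<^locale>\<open>group_action\<close>, hence the restriction of the identity.
\<close>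

definition Euclidean_chart :: "nat \<Rightarrow> (unit, nat \<Rightarrow> real) orbifold_chart" where
  "Euclidean_chart m =
     \<lparr>chart_dom = topspace (Euclidean_space m),
      chart_group = \<lparr>carrier = UNIV, mult = (\<lambda>_ _. ()), one = ()\<rparr>,
      chart_act = (\<lambda>_. restrict (\<lambda>x. x) (topspace (Euclidean_space m))),
      chart_map = (\<lambda>x. x)\<rparr>"

definition Euclidean_orbifold :: "nat \<Rightarrow> (unit, nat \<Rightarrow> real) orbifold_chart set set" where
  "Euclidean_orbifold m = atlas_class m (Euclidean_space m) {Euclidean_chart m}"

definition subanalytic_orbifold_map ::
    "nat \<Rightarrow> 'a topology \<Rightarrow> ('g, 'a) orbifold_chart set set \<Rightarrow>
     nat \<Rightarrow> 'b topology \<Rightarrow> ('h, 'b) orbifold_chart set set \<Rightarrow> ('a \<Rightarrow> 'b) \<Rightarrow> bool" where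
  "subanalytic_orbifold_map n X \<OO> m Y \<P> f \<longleftrightarrow>
     f ` topspace X \<subseteq> topspace Y \<and>
     (\<forall>x\<in>topspace X. \<exists>c\<in>\<Union>\<OO>. \<exists>d\<in>\<Union>\<P>. \<exists>\<theta> F.
        x \<in> chart_image c \<and> f x \<in> chart_image d \<and>
        \<theta> \<in> hom (chart_group c) (chart_group d) \<and>
        subanalytic_map n (chart_dom c) (chart_dom c) m (chart_dom d) (chart_dom d) F \<and>
        (\<forall>g\<in>carrier (chart_group c). \<forall>u\<in>chart_dom c. F (chart_act c g u) = chart_act d (\<theta> g) (F u)) \<and>
        (\<forall>u\<in>chart_dom c. chart_map d (F u) = f (chart_map c u)))"


section \<open>Simplicial complexes\<close>

text \<open>
  Complexes are abstract; the points of the space of \<open>K\<close> are given by barycentric coordinates, and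
  its topology is coherent with the closed simplices.
\<close>

definition simplicial_complex :: "'v set set \<Rightarrow> bool" where
  "simplicial_complex K \<longleftrightarrow>
     (\<forall>s\<in>K. finite s \<and> s \<noteq> {} \<and> (\<forall>t. t \<subseteq> s \<and> t \<noteq> {} \<longrightarrow> t \<in> K))"

definition locally_finite_complex :: "'v set set \<Rightarrow> bool" where
  "locally_finite_complex K \<longleftrightarrow> (\<forall>v. finite {s\<in>K. v \<in> s})"

definition closed_simplex :: "'v set \<Rightarrow> ('v \<Rightarrow> real) set" where
  "closed_simplex s = {b. (\<forall>v. 0 \<le> b v) \<and> (\<forall>v. v \<notin> s \<longrightarrow> b v = 0) \<and> sum b s = 1}"

definition complex_space :: "'v set set \<Rightarrow> ('v \<Rightarrow> real) set" where
  "complex_space K = (\<Union>s\<in>K. closed_simplex s)"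

definition complex_topology :: "'v set set \<Rightarrow> ('v \<Rightarrow> real) topology" where
  "complex_topology K = topology (\<lambda>U. U \<subseteq> complex_space K \<and>
     (\<forall>s\<in>K. openin (subtopology (powertop_real UNIV) (closed_simplex s)) (U \<inter> closed_simplex s)))"

lemma openin_complex_topology:
  "openin (complex_topology K) U \<longleftrightarrow> U \<subseteq> complex_space K \<and>
     (\<forall>s\<in>K. openin (subtopology (powertop_real UNIV) (closed_simplex s)) (U \<inter> closed_simplex s))"
proof -
  let ?T = "\<lambda>s. subtopology (powertop_real UNIV) (closed_simplex s)"
  let ?P = "\<lambda>U. U \<subseteq> complex_space K \<and> (\<forall>s\<in>K. openin (?T s) (U \<inter> closed_simplex s))"
  have "?P (U \<inter> V)" if "?P U" "?P V" for U V
  proof -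
    have "U \<inter> V \<inter> closed_simplex s = (U \<inter> closed_simplex s) \<inter> (V \<inter> closed_simplex s)" for s
      by blast
    then show ?thesis
      using that by (metis (no_types, lifting) inf.coboundedI1 openin_Int)
  qed
  moreover have "?P (\<Union>\<U>)" if "\<forall>U\<in>\<U>. ?P U" for \<U>
  proof -
    have "\<Union>\<U> \<inter> closed_simplex s = (\<Union>U\<in>\<U>. U \<inter> closed_simplex s)" for s
      by blast
    moreover have "openin (?T s) (\<Union>U\<in>\<U>. U \<inter> closed_simplex s)" if "s \<in> K" for s
      using \<open>\<forall>U\<in>\<U>. ?P U\<close> that by (intro openin_Union) auto
    ultimately show ?thesis
      using that by (simp add: Union_least)
  qed
  ultimately have "istopology ?P"
    unfolding istopology_def by blast
  then show ?thesis
    unfolding complex_topology_def by (simp add: topology_inverse')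
qed

lemma topspace_complex_topology: "topspace (complex_topology K) = complex_space K"
proof -
  have "complex_space K \<inter> closed_simplex s = closed_simplex s" if "s \<in> K" for s
    using that unfolding complex_space_def by blast
  then have "openin (complex_topology K) (complex_space K)"
    by (simp add: openin_complex_topology openin_subtopology_refl)
  then show ?thesis
    using openin_complex_topology [of K "topspace (complex_topology K)"]
    by (simp add: openin_subset subset_antisym)
qed

definition vertex_point :: "'v \<Rightarrow> 'v \<Rightarrow> real" where
  "vertex_point v = (\<lambda>w. if w = v then 1 else 0)"

definition closed_linear_embedding ::
    "'v set set \<Rightarrow> nat \<Rightarrow> (('v \<Rightarrow> real) \<Rightarrow> nat \<Rightarrow> real) \<Rightarrow> bool" where
  "closed_linear_embedding K m e \<longleftrightarrow>
     embedding_map (complex_topology K) (Euclidean_space m) e \<and>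
     closedin (Euclidean_space m) (e ` complex_space K) \<and>
     (\<forall>s\<in>K. \<forall>b\<in>closed_simplex s. e b = (\<lambda>i. \<Sum>v\<in>s. b v * e (vertex_point v) i))"


section \<open>Subanalytic triangulations\<close>

text \<open>
  The subanalytic structure of \<open>|K|\<close> does not depend on the closed linear embedding inducing it.
  A map into \<open>|K|\<close> is called subanalytic if it is so for some embedding, a map between complexes
  if it is so for all embeddings: the weakest form for the hypothesis on triangulations and the
  strongest one for the transition map.
\<close>

definition subanalytic_into_complex ::
    "nat \<Rightarrow> 'a topology \<Rightarrow> ('g, 'a) orbifold_chart set set \<Rightarrow> 'v set set \<Rightarrow> ('a \<Rightarrow> 'v \<Rightarrow> real) \<Rightarrow> bool" where
  "subanalytic_into_complex n X \<OO> K g \<longleftrightarrow>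
     g ` topspace X \<subseteq> complex_space K \<and>
     (\<exists>m e. closed_linear_embedding K m e \<and>
        subanalytic_orbifold_map n X \<OO> m (Euclidean_space m) (Euclidean_orbifold m) (e \<circ> g))"

definition subanalytic_triangulation ::
    "nat \<Rightarrow> 'a topology \<Rightarrow> ('g, 'a) orbifold_chart set set \<Rightarrow> 'v set set \<Rightarrow> (('v \<Rightarrow> real) \<Rightarrow> 'a) \<Rightarrow> bool" where
  "subanalytic_triangulation n X \<OO> K \<tau> \<longleftrightarrow>
     simplicial_complex K \<and> countable K \<and> locally_finite_complex K \<and>
     homeomorphic_map (complex_topology K) X \<tau> \<and>
     subanalytic_into_complex n X \<OO> K (inv_into (complex_space K) \<tau>)"

definition subanalytic_complex_map ::
    "'v set set \<Rightarrow> 'w set set \<Rightarrow> (('v \<Rightarrow> real) \<Rightarrow> 'w \<Rightarrow> real) \<Rightarrow> bool" where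
  "subanalytic_complex_map K L f \<longleftrightarrow>
     f ` complex_space K \<subseteq> complex_space L \<and>
     (\<forall>m e k d. closed_linear_embedding K m e \<and> closed_linear_embedding L k d \<longrightarrow>
        subanalytic_map m (topspace (Euclidean_space m)) (e ` complex_space K)
                        k (topspace (Euclidean_space k)) (d ` complex_space L)
                        (d \<circ> f \<circ> inv_into (complex_space K) e))"

definition subanalytic_complex_homeomorphism ::
    "'v set set \<Rightarrow> 'w set set \<Rightarrow> (('v \<Rightarrow> real) \<Rightarrow> 'w \<Rightarrow> real) \<Rightarrow> bool" where
  "subanalytic_complex_homeomorphism K L f \<longleftrightarrow>
     bij_betw f (complex_space K) (complex_space L) \<and>
     subanalytic_complex_map K L f \<and>
     subanalytic_complex_map L K (inv_into (complex_space K) f)"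

end

theory Submission
  imports Defs
begin

text \<open>
  Write \<open>f\<^sub>1\<close> and \<open>f\<^sub>2\<close> for the maps from \<open>X\<close> to \<open>\<real>\<^sup>k\<close> and \<open>\<real>\<^sup>m\<close> given by
  \<open>\<tau>\<^sub>1\<inverse>\<close> and \<open>\<tau>\<^sub>2\<inverse>\<close> followed by closed linear embeddings of the complexes. The graph of the transition
  map is the set of the pairs \<open>(f\<^sub>2 x, f\<^sub>1 x)\<close> for \<open>x\<close> in \<open>X\<close>, and it has to be
  exhibited near each point of \<open>\<real>\<^sup>m\<^sup>+\<^sup>k\<close> as the projection of a bounded semianalytic set. Call such projections
  bounded subanalytic.

  The embedding of the second complex is closed, so the points \<open>x\<close> with \<open>f\<^sub>2 x\<close> in a given box form
  a compact subset of \<open>X\<close>. As finite unions of bounded subanalytic sets are bounded subanalytic, it suffices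
  that each point of \<open>X\<close> has a neighbourhood over which the pairs form such a set
  (\<open>transition_locally_subanalytic\<close>).

  Near \<open>x\<close> the pair \<open>(f\<^sub>2 x, f\<^sub>1 x)\<close> is found by passing through a chain of spaces: from \<open>f\<^sub>2 x\<close> back
  to a chart \<open>c\<close> in which \<open>f\<^sub>2\<close> is subanalytic, from there through charts that embed into
  one another to a chart \<open>c'\<close> in which \<open>f\<^sub>1\<close> is subanalytic, then to \<open>f\<^sub>1 x\<close>. Every step of the
  chain is a bounded subanalytic relation. Such relations are closed under composition and
  converse (\<open>subanalytic_rel_comp\<close>, \<open>subanalytic_rel_converse\<close>): the intermediate points are
  just further coordinates to be projected away. So coordinate changes are never substituted into
  analytic functions; it is enough to adjoin the equation \<open>y = f x\<close>, whose two sides depend on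
  separate variables, and no theorem on compositions of power series enters.

  The relations need not be graphs of functions. Two properties replace this, and both are inherited
  by composites: a relation is sound, meaning that related points lie over the same point of \<open>X\<close>, and it
  is lower semicontinuous at the base point, meaning that nearby points have partners near the
  given partner. In this form it is easy to show that any two charts correspond over
  a common point (\<open>real_analytic_orbifold_coherent\<close>), even though they come from different atlases of
  the class, where a direct embedding would need the transitivity of the equivalence of atlases.

  Finally, the triangulations are subanalytic for some embeddings of the complexes and the conclusion is about
  all of them. Two linear embeddings of a complex differ by a map that is linear on each simplex, hence
  subanalytic on an open star (\<open>subanalytic_germ_change_embedding\<close>): one more link in the chain.
\<close>

section \<open>Reindexing coordinates\<close>

text \<open>
  Selection and permutation of coordinates; the values beyond the target dimension are 0, so that
  the result is always a point of \<open>\<real>\<^sup>n\<close>.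
\<close>

definition coord_map :: "nat \<Rightarrow> (nat \<Rightarrow> nat) \<Rightarrow> (nat \<Rightarrow> real) \<Rightarrow> nat \<Rightarrow> real" where
  "coord_map n \<sigma> x = (\<lambda>i. if i < n then x (\<sigma> i) else 0)"

abbreviation vec_drop :: "nat \<Rightarrow> nat \<Rightarrow> (nat \<Rightarrow> real) \<Rightarrow> nat \<Rightarrow> real" where
  "vec_drop n m \<equiv> coord_map m (\<lambda>i. n + i)"

lemma in_Euclidean_space: "x \<in> topspace (Euclidean_space n) \<longleftrightarrow> (\<forall>i\<ge>n. x i = 0)"
  by (simp add: topspace_Euclidean_space)

lemma vec_take_eq_coord_map: "vec_take n = coord_map n (\<lambda>i. i)"
  by (simp add: fun_eq_iff vec_take_def coord_map_def)

lemma coord_map_in [simp]: "coord_map n \<sigma> x \<in> topspace (Euclidean_space n)"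
  by (simp add: in_Euclidean_space coord_map_def)

lemma vec_take_in [simp]: "vec_take n x \<in> topspace (Euclidean_space n)"
  by (simp add: vec_take_eq_coord_map)

lemma vec_append_in:
  "y \<in> topspace (Euclidean_space m) \<Longrightarrow> vec_append n x y \<in> topspace (Euclidean_space (n + m))"
  by (simp add: in_Euclidean_space vec_append_def)

lemma vec_take_append: "x \<in> topspace (Euclidean_space n) \<Longrightarrow> vec_take n (vec_append n x y) = x"
  by (auto simp: in_Euclidean_space vec_append_def vec_take_def)

lemma vec_drop_append:
  "y \<in> topspace (Euclidean_space m) \<Longrightarrow> vec_drop n m (vec_append n x y) = y"
  by (auto simp: in_Euclidean_space vec_append_def coord_map_def)

lemma vec_append_take_drop:
  "w \<in> topspace (Euclidean_space (n + m)) \<Longrightarrow> vec_append n (vec_take n w) (vec_drop n m w) = w"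
  by (auto simp: in_Euclidean_space vec_append_def vec_take_def coord_map_def)

lemma vec_Times_iff:
  assumes "A \<subseteq> topspace (Euclidean_space n)" "B \<subseteq> topspace (Euclidean_space m)"
  shows "vec_Times n A B =
    {w \<in> topspace (Euclidean_space (n + m)). vec_take n w \<in> A \<and> vec_drop n m w \<in> B}"
proof (intro equalityI subsetI)
  fix w assume "w \<in> vec_Times n A B"
  then obtain x y where "w = vec_append n x y" "x \<in> A" "y \<in> B"
    unfolding vec_Times_def by blast
  moreover have "x \<in> topspace (Euclidean_space n)" "y \<in> topspace (Euclidean_space m)"
    using assms calculation by blast+
  ultimately show "w \<in> {w \<in> topspace (Euclidean_space (n + m)). vec_take n w \<in> A \<and> vec_drop n m w \<in> B}"
    by (simp add: vec_append_in vec_take_append vec_drop_append)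
next
  fix w assume "w \<in> {w \<in> topspace (Euclidean_space (n + m)). vec_take n w \<in> A \<and> vec_drop n m w \<in> B}"
  then show "w \<in> vec_Times n A B"
    unfolding vec_Times_def mem_Collect_eq using vec_append_take_drop [of w n m] by metis
qed

lemma vec_Times_Euclidean_space:
  "vec_Times n (topspace (Euclidean_space n)) (topspace (Euclidean_space m))
   = topspace (Euclidean_space (n + m))"
  by (subst vec_Times_iff) auto

lemma continuous_map_coordinate:
  "continuous_map (Euclidean_space n) euclideanreal (\<lambda>x. x i)"
  unfolding Euclidean_space_def
  by (intro continuous_map_from_subtopology continuous_map_product_projection) auto

lemma continuous_map_coord_map:
  "continuous_map (Euclidean_space N) (Euclidean_space n) (coord_map n \<sigma>)"
proof -
  have "coord_map n \<sigma> = (\<lambda>x i. if i < n then x (\<sigma> i) else 0)"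
    by (simp add: fun_eq_iff coord_map_def)
  then show ?thesis
    using continuous_map_componentwise_Euclidean_space [of "Euclidean_space N" n "\<lambda>x i. x (\<sigma> i)"]
    by (simp add: continuous_map_coordinate)
qed

lemma continuous_map_vec_take: "continuous_map (Euclidean_space N) (Euclidean_space n) (vec_take n)"
  by (simp add: vec_take_eq_coord_map continuous_map_coord_map)

lemma openin_coord_map_preimage:
  assumes "openin (Euclidean_space n) U"
  shows "openin (Euclidean_space N) {w \<in> topspace (Euclidean_space N). coord_map n \<sigma> w \<in> U}"
  using continuous_map_coord_map assms by (rule openin_continuous_map_preimage)

lemma openin_vec_take_preimage:
  assumes "openin (Euclidean_space n) U"
  shows "openin (Euclidean_space N) {w \<in> topspace (Euclidean_space N). vec_take n w \<in> U}"
  using continuous_map_vec_take assms by (rule openin_continuous_map_preimage)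

lemma openin_vec_Times:
  assumes "openin (Euclidean_space n) A" "openin (Euclidean_space m) B"
  shows "openin (Euclidean_space (n + m)) (vec_Times n A B)"
proof -
  have "vec_Times n A B =
     {w \<in> topspace (Euclidean_space (n + m)). vec_take n w \<in> A} \<inter>
     {w \<in> topspace (Euclidean_space (n + m)). vec_drop n m w \<in> B}"
    using vec_Times_iff [OF openin_subset openin_subset, OF assms] by auto
  then show ?thesis
    by (simp add: assms openin_Int openin_coord_map_preimage openin_vec_take_preimage)
qed

section \<open>Boxes\<close>

definition open_box :: "nat \<Rightarrow> (nat \<Rightarrow> real) \<Rightarrow> real \<Rightarrow> (nat \<Rightarrow> real) set" where
  "open_box n a r = {x \<in> topspace (Euclidean_space n). \<forall>i<n. \<bar>x i - a i\<bar> < r}"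

definition closed_box :: "nat \<Rightarrow> (nat \<Rightarrow> real) \<Rightarrow> real \<Rightarrow> (nat \<Rightarrow> real) set" where
  "closed_box n a r = {x \<in> topspace (Euclidean_space n). \<forall>i<n. \<bar>x i - a i\<bar> \<le> r}"

lemma open_box_subset_closed_box: "open_box n a r \<subseteq> closed_box n a r"
  by (auto simp: open_box_def closed_box_def intro: less_imp_le)

lemma centre_in_open_box: "a \<in> topspace (Euclidean_space n) \<Longrightarrow> 0 < r \<Longrightarrow> a \<in> open_box n a r"
  by (simp add: open_box_def)

lemma openin_open_box: "openin (Euclidean_space n) (open_box n a r)"
proof -
  have "openin (Euclidean_space n)
     {x \<in> topspace (Euclidean_space n). x i \<in> {a i - r <..< a i + r}}" for i
    by (intro openin_continuous_map_preimage [OF continuous_map_coordinate]) auto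
  then have "openin (Euclidean_space n) (\<Inter>i\<in>{..<n}. {x \<in> topspace (Euclidean_space n). x i \<in> {a i - r <..< a i + r}})"
    if "n \<noteq> 0"
    using that by (intro openin_INT2) auto
  moreover have "open_box n a r =
      (\<Inter>i\<in>{..<n}. {x \<in> topspace (Euclidean_space n). x i \<in> {a i - r <..< a i + r}})" if "n \<noteq> 0"
  proof -
    have "\<bar>x i - a i\<bar> < r \<longleftrightarrow> x i \<in> {a i - r <..< a i + r}" for x :: "nat \<Rightarrow> real" and i
      by auto
    then show ?thesis
      using that by (auto simp: open_box_def)
  qed
  moreover have "open_box n a r = topspace (Euclidean_space n)" if "n = 0"
    using that by (simp add: open_box_def)
  ultimately show ?thesis
    by (cases "n = 0") auto
qed

lemma compactin_closed_box: "compactin (Euclidean_space n) (closed_box n a r)"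
proof -
  let ?S = "\<lambda>i. if i < n then {a i - r .. a i + r} else {0}"
  have "compactin (powertop_real UNIV) (PiE UNIV ?S)"
    by (simp add: compactin_PiE)
  moreover have "closed_box n a r = PiE UNIV ?S"
  proof (rule Set.set_eqI)
    fix x :: "nat \<Rightarrow> real"
    have "x \<in> PiE UNIV ?S \<longleftrightarrow> (\<forall>i. x i \<in> ?S i)"
      by (simp add: PiE_def Pi_def)
    also have "\<dots> \<longleftrightarrow> (\<forall>i. (n \<le> i \<longrightarrow> x i = 0) \<and> (i < n \<longrightarrow> \<bar>x i - a i\<bar> \<le> r))"
    proof (rule arg_cong [where f = All], rule ext)
      show "(x i \<in> ?S i) = ((n \<le> i \<longrightarrow> x i = 0) \<and> (i < n \<longrightarrow> \<bar>x i - a i\<bar> \<le> r))" for i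
        by (cases "i < n") (auto simp: abs_le_iff)
    qed
    finally show "x \<in> closed_box n a r \<longleftrightarrow> x \<in> PiE UNIV ?S"
      by (auto simp: closed_box_def in_Euclidean_space)
  qed
  ultimately show ?thesis
    unfolding Euclidean_space_def
    by (auto simp: compactin_subtopology closed_box_def in_Euclidean_space)
qed

lemma Hausdorff_Euclidean_space: "Hausdorff_space (Euclidean_space n)"
  unfolding Euclidean_space_def
  by (simp add: Hausdorff_space_subtopology Hausdorff_space_product_topology)

lemma closedin_closed_box: "closedin (Euclidean_space n) (closed_box n a r)"
  by (simp add: Hausdorff_Euclidean_space compactin_closed_box compactin_imp_closedin)

lemma open_box_in_open:
  assumes "openin (Euclidean_space n) U" "a \<in> U"
  obtains r where "0 < r" "open_box n a r \<subseteq> U"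
proof -
  obtain V where V: "openin (powertop_real UNIV) V" "U = V \<inter> {x. \<forall>i\<ge>n. x i = 0}"
    using assms by (auto simp: Euclidean_space_def openin_subtopology)
  have "a \<in> V"
    using assms V by blast
  then obtain W where W: "\<And>i. open (W i)" "a \<in> PiE UNIV W" "PiE UNIV W \<subseteq> V"
    using V(1) by (force simp: openin_product_topology_alt)
  have "\<exists>\<delta>>0. \<forall>t. \<bar>t - a i\<bar> < \<delta> \<longrightarrow> t \<in> W i" for i
  proof -
    have "a i \<in> W i"
      using W(2) by auto
    then show ?thesis
      using W(1) [of i] by (auto simp: open_dist dist_real_def)
  qed
  then obtain \<delta> where \<delta>: "\<And>i. 0 < \<delta> i" "\<And>i t. \<bar>t - a i\<bar> < \<delta> i \<Longrightarrow> t \<in> W i"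
    by metis
  define r where "r = Min (insert 1 (\<delta> ` {..<n}))"
  have "0 < r"
    using \<delta>(1) by (auto simp: r_def)
  moreover have "open_box n a r \<subseteq> U"
  proof
    fix x assume x: "x \<in> open_box n a r"
    have "x i \<in> W i" for i
    proof (cases "i < n")
      case True
      then have "r \<le> \<delta> i"
        by (simp add: r_def)
      moreover have "\<bar>x i - a i\<bar> < r"
        using x True by (simp add: open_box_def)
      ultimately show ?thesis
        by (intro \<delta>(2)) simp
    next
      case False
      then have "x i = a i"
        using x assms V by (simp add: open_box_def in_Euclidean_space)
      then show ?thesis
        using \<delta> by simp
    qed
    then show "x \<in> U"
      using V W x by (auto simp: open_box_def in_Euclidean_space PiE_def Pi_def)
  qed
  ultimately show thesis ..
qed

lemma closed_box_in_open:
  assumes "openin (Euclidean_space n) U" "a \<in> U"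
  obtains r where "0 < r" "closed_box n a r \<subseteq> U"
proof -
  obtain r where r: "0 < r" "open_box n a r \<subseteq> U"
    using assms by (rule open_box_in_open)
  have "closed_box n a (r / 2) \<subseteq> open_box n a r"
    using r by (fastforce simp: closed_box_def open_box_def)
  then show thesis
    using r that [of "r / 2"] by auto
qed

text \<open>
  The bound is over all indices: the sets to which this is applied lie in some \<open>\<real>\<^sup>n\<close>, so that the
  coordinates from \<open>n\<close> on vanish.
\<close>

definition bounded_coords :: "(nat \<Rightarrow> real) set \<Rightarrow> bool" where
  "bounded_coords A \<longleftrightarrow> (\<exists>r. \<forall>x\<in>A. \<forall>i. \<bar>x i\<bar> \<le> r)"

lemma bounded_coords_closed_box:
  assumes "A \<subseteq> topspace (Euclidean_space n)" "bounded_coords A"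
  obtains r where "0 \<le> r" "A \<subseteq> closed_box n (\<lambda>i. 0) r"
proof -
  obtain r where "\<forall>x\<in>A. \<forall>i. \<bar>x i\<bar> \<le> r"
    using assms by (auto simp: bounded_coords_def)
  then have "\<bar>x i\<bar> \<le> max r 0" if "x \<in> A" for x i
    using that by (simp add: le_max_iff_disj)
  then have "A \<subseteq> closed_box n (\<lambda>i. 0) (max r 0)"
    using assms(1) unfolding closed_box_def by auto
  then show thesis
    using that [of "max r 0"] by simp
qed

lemma bounded_coordsI:
  assumes "A \<subseteq> topspace (Euclidean_space n)" "\<And>i. i < n \<Longrightarrow> \<exists>r. \<forall>x\<in>A. \<bar>x i\<bar> \<le> r"
  shows "bounded_coords A"
proof -
  have "\<forall>i. \<exists>r. i < n \<longrightarrow> (\<forall>x\<in>A. \<bar>x i\<bar> \<le> r)"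
    using assms(2) by blast
  then obtain r where r: "\<And>i x. i < n \<Longrightarrow> x \<in> A \<Longrightarrow> \<bar>x i\<bar> \<le> r i"
    by metis
  have "\<bar>x i\<bar> \<le> Max (insert 0 (r ` {..<n}))" if "x \<in> A" for x i
  proof (cases "i < n")
    case True
    then have "r i \<le> Max (insert 0 (r ` {..<n}))"
      by (intro Max_ge) auto
    then show ?thesis
      using r [OF True that] by linarith
  next
    case False
    then have "x i = 0"
      using assms(1) that by (auto simp: in_Euclidean_space)
    then show ?thesis
      by simp
  qed
  then show ?thesis
    unfolding bounded_coords_def by blast
qed

lemma bounded_coords_compactin:
  assumes "compactin (Euclidean_space n) A"
  shows "bounded_coords A"
proof (rule bounded_coordsI [of _ n])
  show "A \<subseteq> topspace (Euclidean_space n)"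
    using assms by (rule compactin_subset_topspace)
  fix i
  have "compactin euclideanreal ((\<lambda>x. x i) ` A)"
    using assms continuous_map_coordinate by (rule image_compactin)
  then have "bounded ((\<lambda>x. x i) ` A)"
    by (simp add: compact_imp_bounded)
  then show "\<exists>r. \<forall>x\<in>A. \<bar>x i\<bar> \<le> r"
    by (auto simp: bounded_iff)
qed

lemma bounded_coords_subset: "bounded_coords B \<Longrightarrow> A \<subseteq> B \<Longrightarrow> bounded_coords A"
  unfolding bounded_coords_def by blast

section \<open>Real analytic functions\<close>

text \<open>
  The witnesses \<open>c\<close> and \<open>r\<close> of analyticity at \<open>a\<close> are made explicit, so that the power series of sums,
  multiples and pullbacks can be written down.
\<close>

definition has_expansion ::
    "nat \<Rightarrow> (nat \<Rightarrow> real) set \<Rightarrow> ((nat \<Rightarrow> real) \<Rightarrow> real) \<Rightarrow> (nat \<Rightarrow> real) \<Rightarrow> ((nat \<Rightarrow> nat) \<Rightarrow> real) \<Rightarrow> real \<Rightarrow> bool"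
  where "has_expansion n U f a c r \<longleftrightarrow> 0 < r \<and> (\<forall>x\<in>U. (\<forall>i<n. \<bar>x i - a i\<bar> < r) \<longrightarrow>
           ((\<lambda>\<alpha>. c \<alpha> * (\<Prod>i<n. (x i - a i) ^ \<alpha> i)) has_sum f x) (multi_indices n))"

lemma real_analytic_fun_iff:
  "real_analytic_fun n U f \<longleftrightarrow> (\<forall>a\<in>U. \<exists>c r. has_expansion n U f a c r)"
  unfolding real_analytic_fun_def has_expansion_def ..

lemma has_expansionI:
  assumes "0 < r" "\<And>x. x \<in> U \<Longrightarrow> (\<And>i. i < n \<Longrightarrow> \<bar>x i - a i\<bar> < r) \<Longrightarrow>
           ((\<lambda>\<alpha>. c \<alpha> * (\<Prod>i<n. (x i - a i) ^ \<alpha> i)) has_sum f x) (multi_indices n)"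
  shows "has_expansion n U f a c r"
  using assms unfolding has_expansion_def by blast

lemma has_expansionD:
  assumes "has_expansion n U f a c r" "x \<in> U" "\<And>i. i < n \<Longrightarrow> \<bar>x i - a i\<bar> < r"
  shows "((\<lambda>\<alpha>. c \<alpha> * (\<Prod>i<n. (x i - a i) ^ \<alpha> i)) has_sum f x) (multi_indices n)"
  using assms unfolding has_expansion_def by blast

lemma has_expansion_pos: "has_expansion n U f a c r \<Longrightarrow> 0 < r"
  by (simp add: has_expansion_def)

lemma has_expansion_subset:
  "has_expansion n U f a c r \<Longrightarrow> V \<subseteq> U \<Longrightarrow> has_expansion n V f a c r"
  unfolding has_expansion_def by blast

lemma real_analytic_fun_subset:
  "real_analytic_fun n U f \<Longrightarrow> V \<subseteq> U \<Longrightarrow> real_analytic_fun n V f"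
  unfolding real_analytic_fun_iff by (blast intro: has_expansion_subset)

lemma has_expansion_const: "has_expansion n U (\<lambda>x. k) a (\<lambda>\<alpha>. if \<alpha> = (\<lambda>i. 0) then k else 0) 1"
proof (rule has_expansionI)
  fix x :: "nat \<Rightarrow> real"
  show "((\<lambda>\<alpha>. (if \<alpha> = (\<lambda>i. 0) then k else 0) * (\<Prod>i<n. (x i - a i) ^ \<alpha> i)) has_sum k)
      (multi_indices n)"
    by (rule has_sum_finite_neutralI [of "{\<lambda>i. 0}"]) (auto simp: multi_indices_def)
qed simp

lemma real_analytic_fun_const: "real_analytic_fun n U (\<lambda>x. k)"
  unfolding real_analytic_fun_iff using has_expansion_const by blast

lemma has_expansion_add:
  assumes "has_expansion n U f a c r" "has_expansion n U g a d s"
  shows "has_expansion n U (\<lambda>x. f x + g x) a (\<lambda>\<alpha>. c \<alpha> + d \<alpha>) (min r s)"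
proof (rule has_expansionI)
  fix x assume x: "x \<in> U" "\<And>i. i < n \<Longrightarrow> \<bar>x i - a i\<bar> < min r s"
  have "((\<lambda>\<alpha>. c \<alpha> * (\<Prod>i<n. (x i - a i) ^ \<alpha> i)) has_sum f x) (multi_indices n)"
    using x by (intro has_expansionD [OF assms(1)]) simp_all
  moreover have "((\<lambda>\<alpha>. d \<alpha> * (\<Prod>i<n. (x i - a i) ^ \<alpha> i)) has_sum g x) (multi_indices n)"
    using x by (intro has_expansionD [OF assms(2)]) simp_all
  ultimately show "((\<lambda>\<alpha>. (c \<alpha> + d \<alpha>) * (\<Prod>i<n. (x i - a i) ^ \<alpha> i)) has_sum (f x + g x)) (multi_indices n)"
    unfolding distrib_right by (rule has_sum_add)
qed (use assms in \<open>auto dest: has_expansion_pos\<close>)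

lemma real_analytic_fun_add:
  "real_analytic_fun n U f \<Longrightarrow> real_analytic_fun n U g \<Longrightarrow> real_analytic_fun n U (\<lambda>x. f x + g x)"
  unfolding real_analytic_fun_iff by (blast intro: has_expansion_add)

lemma has_expansion_cmult:
  assumes "has_expansion n U f a c r"
  shows "has_expansion n U (\<lambda>x. k * f x) a (\<lambda>\<alpha>. k * c \<alpha>) r"
proof (rule has_expansionI)
  fix x assume "x \<in> U" "\<And>i. i < n \<Longrightarrow> \<bar>x i - a i\<bar> < r"
  then show "((\<lambda>\<alpha>. (k * c \<alpha>) * (\<Prod>i<n. (x i - a i) ^ \<alpha> i)) has_sum (k * f x)) (multi_indices n)"
    unfolding mult.assoc by (intro has_sum_cmult_right has_expansionD [OF assms])
qed (use assms in \<open>auto dest: has_expansion_pos\<close>)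

lemma real_analytic_fun_cmult:
  "real_analytic_fun n U f \<Longrightarrow> real_analytic_fun n U (\<lambda>x. k * f x)"
  unfolding real_analytic_fun_iff by (blast intro: has_expansion_cmult)

lemma real_analytic_fun_diff:
  assumes "real_analytic_fun n U f" "real_analytic_fun n U g"
  shows "real_analytic_fun n U (\<lambda>x. f x - g x)"
  using real_analytic_fun_add [OF assms(1) real_analytic_fun_cmult [OF assms(2), of "-1"]] by simp

lemma real_analytic_fun_sum:
  assumes "finite J" "\<And>j. j \<in> J \<Longrightarrow> real_analytic_fun n U (f j)"
  shows "real_analytic_fun n U (\<lambda>x. \<Sum>j\<in>J. f j x)"
  using assms
  by (induction rule: finite_induct) (auto intro: real_analytic_fun_const real_analytic_fun_add)

lemma real_analytic_fun_coordinate: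
  assumes "j < n"
  shows "real_analytic_fun n U (\<lambda>x. x j)"
  unfolding real_analytic_fun_iff
proof
  fix a :: "nat \<Rightarrow> real"
  define e where "e = (\<lambda>i. if i = j then 1 else 0 :: nat)"
  have "has_expansion n U (\<lambda>x. x j - a j) a (\<lambda>\<alpha>. if \<alpha> = e then 1 else 0) 1"
  proof (rule has_expansionI)
    fix x :: "nat \<Rightarrow> real"
    have "(\<Prod>i<n. (x i - a i) ^ e i) = (\<Prod>i\<in>{j}. (x i - a i) ^ e i)"
      using assms by (intro prod.mono_neutral_right) (auto simp: e_def)
    then show "((\<lambda>\<alpha>. (if \<alpha> = e then 1 else 0) * (\<Prod>i<n. (x i - a i) ^ \<alpha> i)) has_sum (x j - a j))
        (multi_indices n)"
      using assms
      by (intro has_sum_finite_neutralI [of "{e}"]) (auto simp: multi_indices_def e_def)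
  qed simp
  then have "has_expansion n U (\<lambda>x. x j - a j + a j) a
      (\<lambda>\<alpha>. (if \<alpha> = e then 1 else 0) + (if \<alpha> = (\<lambda>i. 0) then a j else 0)) (min 1 1)"
    by (rule has_expansion_add) (rule has_expansion_const)
  then show "\<exists>c r. has_expansion n U (\<lambda>x. x j) a c r"
    by auto
qed

text \<open>
  The power series of the pullback has the old coefficients at the multi-indices supported on the
  image of \<open>\<sigma>\<close>, and 0 elsewhere. This is the only instance of a composition of
  analytic maps that the proof needs.
\<close>

lemma real_analytic_fun_coord_map:
  assumes f: "real_analytic_fun n U f" and inj: "inj_on \<sigma> {..<n}" and \<sigma>: "\<sigma> ` {..<n} \<subseteq> {..<N}"
    and V: "coord_map n \<sigma> ` V \<subseteq> U"
  shows "real_analytic_fun N V (\<lambda>x. f (coord_map n \<sigma> x))"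
  unfolding real_analytic_fun_iff
proof
  fix a assume "a \<in> V"
  with V have "coord_map n \<sigma> a \<in> U"
    by blast
  with f obtain c r where c: "has_expansion n U f (coord_map n \<sigma> a) c r"
    unfolding real_analytic_fun_iff by blast
  \<comment> \<open>Multi-indices are carried along \<open>\<sigma>\<close> and extended by 0.\<close>
  define \<iota> :: "(nat \<Rightarrow> nat) \<Rightarrow> nat \<Rightarrow> nat"
    where "\<iota> \<alpha> j = (if j \<in> \<sigma> ` {..<n} then \<alpha> (the_inv_into {..<n} \<sigma> j) else 0)" for \<alpha> j
  have \<iota>_\<sigma>: "\<iota> \<alpha> (\<sigma> i) = \<alpha> i" if "i < n" for \<alpha> i
    using that inj by (simp add: \<iota>_def the_inv_into_f_f)
  have inj_\<iota>: "inj_on \<iota> (multi_indices n)"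
  proof (rule inj_onI)
    fix \<alpha> \<beta> assume "\<alpha> \<in> multi_indices n" "\<beta> \<in> multi_indices n" "\<iota> \<alpha> = \<iota> \<beta>"
    then have "\<alpha> i = \<beta> i" for i
      using \<iota>_\<sigma> [of i \<alpha>] \<iota>_\<sigma> [of i \<beta>] by (cases "i < n") (auto simp: multi_indices_def)
    then show "\<alpha> = \<beta>" ..
  qed
  have \<iota>_in: "\<iota> ` multi_indices n \<subseteq> multi_indices N"
    using \<sigma> by (force simp: multi_indices_def \<iota>_def)
  define c' where "c' \<beta> = (if \<beta> \<in> \<iota> ` multi_indices n
      then c (the_inv_into (multi_indices n) \<iota> \<beta>) else 0)" for \<beta>
  have "has_expansion N V (\<lambda>x. f (coord_map n \<sigma> x)) a c' r"
  proof (rule has_expansionI)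
    fix x assume x: "x \<in> V" "\<And>j. j < N \<Longrightarrow> \<bar>x j - a j\<bar> < r"
    let ?g = "\<lambda>\<beta>. c' \<beta> * (\<Prod>j<N. (x j - a j) ^ \<beta> j)"
    let ?x = "coord_map n \<sigma> x"
    have "?x \<in> U"
      using V x by blast
    moreover have "\<bar>?x i - coord_map n \<sigma> a i\<bar> < r" if "i < n" for i
    proof -
      have "\<sigma> i < N"
        using that \<sigma> by blast
      then show ?thesis
        using x(2) that by (simp add: coord_map_def)
    qed
    ultimately have sum: "((\<lambda>\<alpha>. c \<alpha> * (\<Prod>i<n. (?x i - coord_map n \<sigma> a i) ^ \<alpha> i)) has_sum f ?x)
        (multi_indices n)"
      by (rule has_expansionD [OF c])
    have "(?g \<circ> \<iota>) \<alpha> = c \<alpha> * (\<Prod>i<n. (?x i - coord_map n \<sigma> a i) ^ \<alpha> i)"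
      if \<alpha>: "\<alpha> \<in> multi_indices n" for \<alpha>
    proof -
      have "(\<Prod>j<N. (x j - a j) ^ \<iota> \<alpha> j) = (\<Prod>j\<in>\<sigma> ` {..<n}. (x j - a j) ^ \<iota> \<alpha> j)"
        using \<sigma> by (intro prod.mono_neutral_right) (auto simp: \<iota>_def)
      also have "\<dots> = (\<Prod>i<n. (?x i - coord_map n \<sigma> a i) ^ \<alpha> i)"
        using \<iota>_\<sigma> by (subst prod.reindex [OF inj]) (auto simp: coord_map_def intro!: prod.cong)
      finally show ?thesis
        using \<alpha> inj_\<iota> by (simp add: c'_def the_inv_into_f_f)
    qed
    then have "((?g \<circ> \<iota>) has_sum f ?x) (multi_indices n) \<longleftrightarrow>
        ((\<lambda>\<alpha>. c \<alpha> * (\<Prod>i<n. (?x i - coord_map n \<sigma> a i) ^ \<alpha> i)) has_sum f ?x) (multi_indices n)"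
      by (rule has_sum_cong)
    with sum have "((?g \<circ> \<iota>) has_sum f ?x) (multi_indices n)"
      by blast
    then have "(?g has_sum f ?x) (\<iota> ` multi_indices n)"
      by (simp add: has_sum_reindex [OF inj_\<iota>])
    moreover have "(?g has_sum f ?x) (\<iota> ` multi_indices n) \<longleftrightarrow> (?g has_sum f ?x) (multi_indices N)"
      using \<iota>_in by (intro has_sum_cong_neutral) (auto simp: c'_def)
    ultimately show "(?g has_sum f ?x) (multi_indices N)"
      by blast
  qed (use c in \<open>rule has_expansion_pos\<close>)
  then show "\<exists>c r. has_expansion N V (\<lambda>x. f (coord_map n \<sigma> x)) a c r"
    by blast
qed

section \<open>Semianalytic sets\<close>

text \<open>
  A pair \<open>(P, Z)\<close> stands for the conditions \<open>f > 0\<close> for \<open>f\<close> in \<open>P\<close> and \<open>f = 0\<close> for \<open>f\<close> in \<open>Z\<close>; a system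
  is a finite disjunction of such conjunctions.
\<close>

definition analytic_system ::
    "nat \<Rightarrow> (nat \<Rightarrow> real) set \<Rightarrow> (((nat \<Rightarrow> real) \<Rightarrow> real) set \<times> ((nat \<Rightarrow> real) \<Rightarrow> real) set) set \<Rightarrow> bool"
  where "analytic_system n U \<F> \<longleftrightarrow> finite \<F> \<and>
     (\<forall>(P, Z)\<in>\<F>. finite P \<and> finite Z \<and> (\<forall>f\<in>P \<union> Z. real_analytic_fun n U f))"

definition solutions ::
    "(nat \<Rightarrow> real) set \<Rightarrow> (((nat \<Rightarrow> real) \<Rightarrow> real) set \<times> ((nat \<Rightarrow> real) \<Rightarrow> real) set) set \<Rightarrow> (nat \<Rightarrow> real) set"
  where "solutions U \<F> = (\<Union>(P, Z)\<in>\<F>. {x\<in>U. (\<forall>f\<in>P. f x > 0) \<and> (\<forall>f\<in>Z. f x = 0)})"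

definition semianalytic_on :: "nat \<Rightarrow> (nat \<Rightarrow> real) set \<Rightarrow> (nat \<Rightarrow> real) set \<Rightarrow> bool" where
  "semianalytic_on n U A \<longleftrightarrow> (\<exists>\<F>. analytic_system n U \<F> \<and> A \<inter> U = solutions U \<F>)"

abbreviation semianalytic :: "nat \<Rightarrow> (nat \<Rightarrow> real) set \<Rightarrow> bool" where
  "semianalytic n \<equiv> semianalytic_in n (topspace (Euclidean_space n))"

lemma semianalytic_in_iff:
  "semianalytic_in n M A \<longleftrightarrow>
     A \<subseteq> M \<and> (\<forall>a\<in>M. \<exists>U. openin (subspace_of n M) U \<and> a \<in> U \<and> semianalytic_on n U A)"
  unfolding semianalytic_in_def semianalytic_on_def analytic_system_def solutions_def
  by (simp only: conj_assoc ex_simps)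

definition satisfies ::
    "(nat \<Rightarrow> real) \<Rightarrow> ((nat \<Rightarrow> real) \<Rightarrow> real) set \<times> ((nat \<Rightarrow> real) \<Rightarrow> real) set \<Rightarrow> bool" where
  "satisfies x S \<longleftrightarrow> (\<forall>f\<in>fst S. f x > 0) \<and> (\<forall>f\<in>snd S. f x = 0)"

lemma solutions_eq: "solutions U \<F> = {x \<in> U. \<exists>S\<in>\<F>. satisfies x S}"
  unfolding solutions_def satisfies_def split_beta by auto

lemma analytic_systemI:
  assumes "finite \<F>" "\<And>S. S \<in> \<F> \<Longrightarrow> finite (fst S)" "\<And>S. S \<in> \<F> \<Longrightarrow> finite (snd S)"
    and "\<And>S f. S \<in> \<F> \<Longrightarrow> f \<in> fst S \<union> snd S \<Longrightarrow> real_analytic_fun n U f"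
  shows "analytic_system n U \<F>"
  using assms by (auto simp: analytic_system_def)

lemma analytic_systemD:
  assumes "analytic_system n U \<F>"
  shows "finite \<F>" "S \<in> \<F> \<Longrightarrow> finite (fst S)" "S \<in> \<F> \<Longrightarrow> finite (snd S)"
    and "S \<in> \<F> \<Longrightarrow> f \<in> fst S \<union> snd S \<Longrightarrow> real_analytic_fun n U f"
  using assms by (auto simp: analytic_system_def split_beta)

lemma semianalytic_subset: "semianalytic n A \<Longrightarrow> A \<subseteq> topspace (Euclidean_space n)"
  by (simp add: semianalytic_in_def)

lemma semianalyticD:
  assumes "semianalytic n A" "a \<in> topspace (Euclidean_space n)"
  obtains U where "openin (Euclidean_space n) U" "a \<in> U" "semianalytic_on n U A"
  using assms by (auto simp: semianalytic_in_iff)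

lemma semianalyticI:
  assumes "A \<subseteq> topspace (Euclidean_space n)"
    and "\<And>a. a \<in> topspace (Euclidean_space n) \<Longrightarrow>
           \<exists>U. openin (Euclidean_space n) U \<and> a \<in> U \<and> semianalytic_on n U A"
  shows "semianalytic n A"
  using assms by (simp add: semianalytic_in_iff)

lemma semianalytic_on_subset:
  assumes "semianalytic_on n U A" "V \<subseteq> U"
  shows "semianalytic_on n V A"
proof -
  obtain \<F> where \<F>: "analytic_system n U \<F>" "A \<inter> U = solutions U \<F>"
    using assms(1) unfolding semianalytic_on_def by blast
  have "analytic_system n V \<F>"
    using analytic_systemD [OF \<F>(1)] real_analytic_fun_subset [OF _ assms(2)]
    by (intro analytic_systemI) simp_all
  moreover have "A \<inter> V = solutions U \<F> \<inter> V"
    using assms(2) \<F>(2) by blast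
  then have "A \<inter> V = solutions V \<F>"
    using assms(2) unfolding solutions_eq by blast
  ultimately show ?thesis
    unfolding semianalytic_on_def by blast
qed

lemma semianalytic_on_cong: "A \<inter> U = B \<inter> U \<Longrightarrow> semianalytic_on n U A \<longleftrightarrow> semianalytic_on n U B"
  by (simp add: semianalytic_on_def)

lemma semianalytic_on_empty: "A \<inter> U = {} \<Longrightarrow> semianalytic_on n U A"
  unfolding semianalytic_on_def
  by (intro exI [of _ "{}"]) (simp add: solutions_def analytic_system_def)

lemma semianalytic_on_UNIV: "semianalytic_on n U UNIV"
  unfolding semianalytic_on_def
  by (intro exI [of _ "{({}, {})}"]) (simp add: solutions_def analytic_system_def)

lemma semianalytic_on_positive:
  "real_analytic_fun n U f \<Longrightarrow> semianalytic_on n U {x. f x > 0}"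
  unfolding semianalytic_on_def
  by (intro exI [of _ "{({f}, {})}"]) (auto simp add: solutions_def analytic_system_def)

lemma semianalytic_on_zero:
  "real_analytic_fun n U f \<Longrightarrow> semianalytic_on n U {x. f x = 0}"
  unfolding semianalytic_on_def
  by (intro exI [of _ "{({}, {f})}"]) (auto simp add: solutions_def analytic_system_def)

lemma semianalytic_on_Un:
  assumes "semianalytic_on n U A" "semianalytic_on n U B"
  shows "semianalytic_on n U (A \<union> B)"
proof -
  obtain \<F> \<G> where \<F>: "analytic_system n U \<F>" "A \<inter> U = solutions U \<F>"
    and \<G>: "analytic_system n U \<G>" "B \<inter> U = solutions U \<G>"
    using assms unfolding semianalytic_on_def by blast
  have "analytic_system n U (\<F> \<union> \<G>)"
    using \<F>(1) \<G>(1) unfolding analytic_system_def ball_Un finite_Un by (elim conjE) (intro conjI)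
  moreover have "(A \<union> B) \<inter> U = solutions U (\<F> \<union> \<G>)"
    unfolding Int_Un_distrib2 \<F>(2) \<G>(2) solutions_eq by blast
  ultimately show ?thesis
    unfolding semianalytic_on_def by blast
qed

text \<open>
  Distributivity: the disjuncts of the intersection are the conjunctions of a disjunct of one system with
  a disjunct of the other.
\<close>

lemma semianalytic_on_Int:
  assumes "semianalytic_on n U A" "semianalytic_on n U B"
  shows "semianalytic_on n U (A \<inter> B)"
proof -
  obtain \<F> \<G> where \<F>: "analytic_system n U \<F>" "A \<inter> U = solutions U \<F>"
    and \<G>: "analytic_system n U \<G>" "B \<inter> U = solutions U \<G>"
    using assms unfolding semianalytic_on_def by blast
  define J where "J = (\<lambda>(S, T). (fst S \<union> fst T :: ((nat \<Rightarrow> real) \<Rightarrow> real) set,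
      snd S \<union> snd T :: ((nat \<Rightarrow> real) \<Rightarrow> real) set))"
  have J: "satisfies x (J (S, T)) \<longleftrightarrow> satisfies x S \<and> satisfies x T" for x S T
    by (auto simp: J_def satisfies_def)
  let ?\<H> = "J ` (\<F> \<times> \<G>)"
  have "analytic_system n U ?\<H>"
    using analytic_systemD [OF \<F>(1)] analytic_systemD [OF \<G>(1)]
    by (intro analytic_systemI) (auto simp: J_def)
  moreover have "A \<inter> B \<inter> U = (A \<inter> U) \<inter> (B \<inter> U)"
    by blast
  then have "A \<inter> B \<inter> U = solutions U ?\<H>"
    unfolding \<F>(2) \<G>(2) solutions_eq by (auto simp: J)
  ultimately show ?thesis
    unfolding semianalytic_on_def by blast
qed

lemma semianalytic_on_Ball:
  assumes "finite I" "\<And>i. i \<in> I \<Longrightarrow> semianalytic_on n U {x. P i x}"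
  shows "semianalytic_on n U {x. \<forall>i\<in>I. P i x}"
  using assms
proof (induction rule: finite_induct)
  case empty
  then show ?case
    using semianalytic_on_UNIV by simp
next
  case (insert i I)
  have "{x. \<forall>j\<in>insert i I. P j x} = {x. P i x} \<inter> {x. \<forall>j\<in>I. P j x}"
    by blast
  then show ?case
    using insert by (simp add: semianalytic_on_Int)
qed

lemma semianalytic_on_nonneg:
  assumes "real_analytic_fun n U f"
  shows "semianalytic_on n U {x. f x \<ge> 0}"
proof -
  have "{x. f x \<ge> 0} = {x. f x > 0} \<union> {x. f x = 0}"
    by auto
  then show ?thesis
    using assms by (simp add: semianalytic_on_Un semianalytic_on_positive semianalytic_on_zero)
qed

lemma semianalytic_on_coord_map:
  assumes A: "semianalytic_on n U A" and \<sigma>: "inj_on \<sigma> {..<n}" "\<sigma> ` {..<n} \<subseteq> {..<N}"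
    and V: "coord_map n \<sigma> ` V \<subseteq> U"
  shows "semianalytic_on N V (coord_map n \<sigma> -` A)"
proof -
  obtain \<F> where \<F>: "analytic_system n U \<F>" "A \<inter> U = solutions U \<F>"
    using assms(1) unfolding semianalytic_on_def by blast
  let ?c = "\<lambda>(f :: (nat \<Rightarrow> real) \<Rightarrow> real) x. f (coord_map n \<sigma> x)"
  define J where "J = (\<lambda>S. (?c ` fst S, ?c ` snd S))"
  have J: "satisfies x (J S) \<longleftrightarrow> satisfies (coord_map n \<sigma> x) S" for x S
    by (auto simp: J_def satisfies_def)
  let ?\<H> = "J ` \<F>"
  have "real_analytic_fun N V (?c f)" if "real_analytic_fun n U f" for f
    using real_analytic_fun_coord_map [OF that \<sigma> V] .
  then have "analytic_system N V ?\<H>"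
    using analytic_systemD [OF \<F>(1)] by (intro analytic_systemI) (auto simp: J_def)
  moreover have "coord_map n \<sigma> -` A \<inter> V = coord_map n \<sigma> -` (A \<inter> U) \<inter> V"
    using V by blast
  then have "coord_map n \<sigma> -` A \<inter> V = solutions V ?\<H>"
    unfolding \<F>(2) solutions_eq using V by (auto simp: J)
  ultimately show ?thesis
    unfolding semianalytic_on_def by blast
qed

lemma semianalytic_globalI:
  assumes "semianalytic_on n (topspace (Euclidean_space n)) {x. P x}"
  shows "semianalytic n {x \<in> topspace (Euclidean_space n). P x}"
proof (rule semianalyticI)
  let ?E = "topspace (Euclidean_space n)"
  fix a assume a: "a \<in> ?E"
  have "{x. P x} \<inter> ?E = {x \<in> ?E. P x} \<inter> ?E"
    by blast
  then have "semianalytic_on n ?E {x \<in> ?E. P x}"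
    using assms semianalytic_on_cong by blast
  with a show "\<exists>U. openin (Euclidean_space n) U \<and> a \<in> U \<and> semianalytic_on n U {x \<in> ?E. P x}"
    by (intro exI [of _ ?E]) simp
qed auto

lemma semianalytic_Int:
  assumes "semianalytic n A" "semianalytic n B"
  shows "semianalytic n (A \<inter> B)"
proof (rule semianalyticI)
  show "A \<inter> B \<subseteq> topspace (Euclidean_space n)"
    using assms semianalytic_subset by blast
  fix a assume a: "a \<in> topspace (Euclidean_space n)"
  obtain U V where "openin (Euclidean_space n) U" "a \<in> U" "semianalytic_on n U A"
    and "openin (Euclidean_space n) V" "a \<in> V" "semianalytic_on n V B"
    using semianalyticD [OF assms(1) a] semianalyticD [OF assms(2) a] by metis
  then show "\<exists>U. openin (Euclidean_space n) U \<and> a \<in> U \<and> semianalytic_on n U (A \<inter> B)"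
    using semianalytic_on_subset [of n U A "U \<inter> V"] semianalytic_on_subset [of n V B "U \<inter> V"]
    by (intro exI [of _ "U \<inter> V"]) (simp add: openin_Int semianalytic_on_Int)
qed

lemma semianalytic_Un:
  assumes "semianalytic n A" "semianalytic n B"
  shows "semianalytic n (A \<union> B)"
proof (rule semianalyticI)
  show "A \<union> B \<subseteq> topspace (Euclidean_space n)"
    using assms semianalytic_subset by blast
  fix a assume a: "a \<in> topspace (Euclidean_space n)"
  obtain U V where "openin (Euclidean_space n) U" "a \<in> U" "semianalytic_on n U A"
    and "openin (Euclidean_space n) V" "a \<in> V" "semianalytic_on n V B"
    using semianalyticD [OF assms(1) a] semianalyticD [OF assms(2) a] by metis
  then show "\<exists>U. openin (Euclidean_space n) U \<and> a \<in> U \<and> semianalytic_on n U (A \<union> B)"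
    using semianalytic_on_subset [of n U A "U \<inter> V"] semianalytic_on_subset [of n V B "U \<inter> V"]
    by (intro exI [of _ "U \<inter> V"]) (simp add: openin_Int semianalytic_on_Un)
qed

lemma semianalytic_empty: "semianalytic n {}"
  using semianalytic_globalI [of n "\<lambda>x. False"] by (simp add: semianalytic_on_empty)

lemma semianalytic_coord_map:
  assumes A: "semianalytic n A" and \<sigma>: "inj_on \<sigma> {..<n}" "\<sigma> ` {..<n} \<subseteq> {..<N}"
  shows "semianalytic N {w \<in> topspace (Euclidean_space N). coord_map n \<sigma> w \<in> A}"
proof (rule semianalyticI)
  fix a assume a: "a \<in> topspace (Euclidean_space N)"
  obtain U where U: "openin (Euclidean_space n) U" "coord_map n \<sigma> a \<in> U" "semianalytic_on n U A"
    using semianalyticD [OF A coord_map_in] .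
  let ?V = "{w \<in> topspace (Euclidean_space N). coord_map n \<sigma> w \<in> U}"
  have "semianalytic_on N ?V (coord_map n \<sigma> -` A)"
    using U(3) \<sigma> by (rule semianalytic_on_coord_map) auto
  moreover have "coord_map n \<sigma> -` A \<inter> ?V =
      {w \<in> topspace (Euclidean_space N). coord_map n \<sigma> w \<in> A} \<inter> ?V"
    by auto
  note semianalytic_on_cong [OF this]
  ultimately have V: "semianalytic_on N ?V {w \<in> topspace (Euclidean_space N). coord_map n \<sigma> w \<in> A}"
    by blast
  then show "\<exists>V. openin (Euclidean_space N) V \<and> a \<in> V \<and>
      semianalytic_on N V {w \<in> topspace (Euclidean_space N). coord_map n \<sigma> w \<in> A}"
    using a U(2) openin_coord_map_preimage [OF U(1)] by (intro exI [of _ ?V]) simp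
qed auto

lemma semianalytic_vec_take:
  assumes "semianalytic n A" "n \<le> N"
  shows "semianalytic N {w \<in> topspace (Euclidean_space N). vec_take n w \<in> A}"
  using semianalytic_coord_map [of n A "\<lambda>i. i" N] assms by (auto simp: vec_take_eq_coord_map)

lemma semianalytic_vec_drop:
  assumes "semianalytic m A"
  shows "semianalytic (n + m) {w \<in> topspace (Euclidean_space (n + m)). vec_drop n m w \<in> A}"
  using assms by (intro semianalytic_coord_map) auto

lemma semianalytic_equations:
  assumes "finite I" "\<And>i. i \<in> I \<Longrightarrow> real_analytic_fun n (topspace (Euclidean_space n)) (f i)"
  shows "semianalytic n {x \<in> topspace (Euclidean_space n). \<forall>i\<in>I. f i x = 0}"
  using assms by (intro semianalytic_globalI semianalytic_on_Ball semianalytic_on_zero)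

lemma semianalytic_inequalities:
  assumes "finite I" "\<And>i. i \<in> I \<Longrightarrow> real_analytic_fun n (topspace (Euclidean_space n)) (f i)"
  shows "semianalytic n {x \<in> topspace (Euclidean_space n). \<forall>i\<in>I. f i x \<ge> 0}"
  using assms by (intro semianalytic_globalI semianalytic_on_Ball semianalytic_on_nonneg)

lemma semianalytic_strict_inequalities:
  assumes "finite I" "\<And>i. i \<in> I \<Longrightarrow> real_analytic_fun n (topspace (Euclidean_space n)) (f i)"
  shows "semianalytic n {x \<in> topspace (Euclidean_space n). \<forall>i\<in>I. f i x > 0}"
  using assms by (intro semianalytic_globalI semianalytic_on_Ball semianalytic_on_positive)

text \<open>
  \<open>\<real>\<^sup>n\<close> is literally a subset of \<open>\<real>\<^sup>N\<close>, cut out by the vanishing of the last coordinates. This makes it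
  possible to bring two projections to the same number of auxiliary variables.
\<close>

lemma semianalytic_mono_dim:
  assumes "semianalytic n A" "n \<le> N"
  shows "semianalytic N A"
proof -
  have "semianalytic N ({w \<in> topspace (Euclidean_space N). vec_take n w \<in> A} \<inter>
      {w \<in> topspace (Euclidean_space N). \<forall>i\<in>{n..<N}. w i = 0})"
    using assms
    by (intro semianalytic_Int semianalytic_vec_take semianalytic_equations
        real_analytic_fun_coordinate) auto
  moreover have "A = {w \<in> topspace (Euclidean_space N). vec_take n w \<in> A} \<inter>
      {w \<in> topspace (Euclidean_space N). \<forall>i\<in>{n..<N}. w i = 0}"
  proof (intro equalityI subsetI)
    fix x assume "x \<in> A"
    then have "\<forall>i\<ge>n. x i = 0"
      using semianalytic_subset [OF assms(1)] by (auto simp: in_Euclidean_space)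
    moreover have "vec_take n x = x"
      using calculation by (auto simp: vec_take_def)
    ultimately show "x \<in> {w \<in> topspace (Euclidean_space N). vec_take n w \<in> A} \<inter>
        {w \<in> topspace (Euclidean_space N). \<forall>i\<in>{n..<N}. w i = 0}"
      using \<open>x \<in> A\<close> assms(2) by (auto simp: in_Euclidean_space)
  next
    fix x assume x: "x \<in> {w \<in> topspace (Euclidean_space N). vec_take n w \<in> A} \<inter>
        {w \<in> topspace (Euclidean_space N). \<forall>i\<in>{n..<N}. w i = 0}"
    then have "x i = 0" if "n \<le> i" for i
      using that by (cases "i < N") (auto simp: in_Euclidean_space)
    then have "vec_take n x = x"
      by (auto simp: vec_take_def)
    then show "x \<in> A"
      using x by auto
  qed
  ultimately show ?thesis
    by simp
qed

lemma real_analytic_fun_box_sides: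
  assumes "i < n"
  shows "real_analytic_fun n U (\<lambda>x. r - (x i - a))" "real_analytic_fun n U (\<lambda>x. r + (x i - a))"
  by (intro real_analytic_fun_add real_analytic_fun_diff real_analytic_fun_const
      real_analytic_fun_coordinate assms)+

lemma semianalytic_closed_box: "semianalytic n (closed_box n a r)"
proof -
  have "semianalytic n ({x \<in> topspace (Euclidean_space n). \<forall>i\<in>{..<n}. r - (x i - a i) \<ge> 0} \<inter>
      {x \<in> topspace (Euclidean_space n). \<forall>i\<in>{..<n}. r + (x i - a i) \<ge> 0})"
    by (intro semianalytic_Int semianalytic_inequalities real_analytic_fun_box_sides) auto
  moreover have "closed_box n a r = {x \<in> topspace (Euclidean_space n). \<forall>i\<in>{..<n}. r - (x i - a i) \<ge> 0} \<inter>
      {x \<in> topspace (Euclidean_space n). \<forall>i\<in>{..<n}. r + (x i - a i) \<ge> 0}"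
    by (auto simp: closed_box_def abs_le_iff algebra_simps)
  ultimately show ?thesis
    by simp
qed

lemma semianalytic_open_box: "semianalytic n (open_box n a r)"
proof -
  have "semianalytic n ({x \<in> topspace (Euclidean_space n). \<forall>i\<in>{..<n}. r - (x i - a i) > 0} \<inter>
      {x \<in> topspace (Euclidean_space n). \<forall>i\<in>{..<n}. r + (x i - a i) > 0})"
    by (intro semianalytic_Int semianalytic_strict_inequalities real_analytic_fun_box_sides) auto
  moreover have "open_box n a r = {x \<in> topspace (Euclidean_space n). \<forall>i\<in>{..<n}. r - (x i - a i) > 0} \<inter>
      {x \<in> topspace (Euclidean_space n). \<forall>i\<in>{..<n}. r + (x i - a i) > 0}"
    by (auto simp: open_box_def abs_less_iff algebra_simps)
  ultimately show ?thesis
    by simp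
qed

section \<open>Bounded subanalytic sets\<close>

text \<open>
  One semianalytic set in a Euclidean space serves for the whole of \<open>A\<close>, so that operations on sets
  downstairs are operations on sets upstairs, with further variables to be projected away.
\<close>

definition bounded_subanalytic :: "nat \<Rightarrow> (nat \<Rightarrow> real) set \<Rightarrow> bool" where
  "bounded_subanalytic n A \<longleftrightarrow>
     (\<exists>p B. semianalytic (n + p) B \<and> bounded_coords B \<and> A = vec_take n ` B)"

lemma bounded_subanalyticI:
  "semianalytic (n + p) B \<Longrightarrow> bounded_coords B \<Longrightarrow> bounded_subanalytic n (vec_take n ` B)"
  unfolding bounded_subanalytic_def by blast

lemma bounded_subanalyticE:
  assumes "bounded_subanalytic n A"
  obtains p B where "semianalytic (n + p) B" "bounded_coords B" "A = vec_take n ` B"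
  using assms unfolding bounded_subanalytic_def by blast

lemma vec_take_id: "x \<in> topspace (Euclidean_space n) \<Longrightarrow> vec_take n x = x"
  by (auto simp: vec_take_def in_Euclidean_space)

lemma bounded_subanalytic_semianalytic:
  assumes "semianalytic n A" "bounded_coords A"
  shows "bounded_subanalytic n A"
proof -
  have "vec_take n ` A = A"
    using semianalytic_subset [OF assms(1)] by (force simp: vec_take_id)
  then show ?thesis
    using bounded_subanalyticI [of n 0 A] assms by simp
qed

lemma bounded_coords_Un:
  assumes "bounded_coords A" "bounded_coords B"
  shows "bounded_coords (A \<union> B)"
proof -
  obtain r s where "\<forall>x\<in>A. \<forall>i. \<bar>x i\<bar> \<le> r" "\<forall>x\<in>B. \<forall>i. \<bar>x i\<bar> \<le> s"
    using assms unfolding bounded_coords_def by blast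
  then have "\<forall>x\<in>A \<union> B. \<forall>i. \<bar>x i\<bar> \<le> max r s"
    by (auto simp: le_max_iff_disj)
  then show ?thesis
    unfolding bounded_coords_def by blast
qed

lemma bounded_subanalytic_empty: "bounded_subanalytic n {}"
  by (simp add: bounded_subanalytic_semianalytic semianalytic_empty bounded_coords_def)

lemma bounded_subanalytic_Un:
  assumes "bounded_subanalytic n A" "bounded_subanalytic n B"
  shows "bounded_subanalytic n (A \<union> B)"
proof -
  obtain p A' where A': "semianalytic (n + p) A'" "bounded_coords A'" "A = vec_take n ` A'"
    using assms(1) by (rule bounded_subanalyticE)
  obtain q B' where B': "semianalytic (n + q) B'" "bounded_coords B'" "B = vec_take n ` B'"
    using assms(2) by (rule bounded_subanalyticE)
  have "semianalytic (n + (p + q)) (A' \<union> B')"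
    using A'(1) B'(1) by (intro semianalytic_Un) (auto elim: semianalytic_mono_dim)
  then show ?thesis
    unfolding A'(3) B'(3) image_Un [symmetric]
    by (rule bounded_subanalyticI) (simp add: bounded_coords_Un A' B')
qed

lemma bounded_subanalytic_UN:
  assumes "finite I" "\<And>i. i \<in> I \<Longrightarrow> bounded_subanalytic n (A i)"
  shows "bounded_subanalytic n (\<Union>i\<in>I. A i)"
  using assms
  by (induction rule: finite_induct) (auto intro: bounded_subanalytic_empty bounded_subanalytic_Un)

lemma bounded_subanalytic_Int:
  assumes "bounded_subanalytic n A" "semianalytic n C"
  shows "bounded_subanalytic n (A \<inter> C)"
proof -
  obtain p B where B: "semianalytic (n + p) B" "bounded_coords B" "A = vec_take n ` B"
    using assms(1) by (rule bounded_subanalyticE)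
  let ?B = "B \<inter> {w \<in> topspace (Euclidean_space (n + p)). vec_take n w \<in> C}"
  have "bounded_subanalytic n (vec_take n ` ?B)"
  proof (rule bounded_subanalyticI)
    show "semianalytic (n + p) ?B"
      using B assms(2) by (intro semianalytic_Int semianalytic_vec_take) auto
    show "bounded_coords ?B"
      using B(2) by (rule bounded_coords_subset) blast
  qed
  moreover have "vec_take n ` ?B = A \<inter> C"
    unfolding B(3) using semianalytic_subset [OF B(1)] by auto
  ultimately show ?thesis
    by simp
qed

subsection \<open>Linear images\<close>

definition linear_coords ::
    "nat \<Rightarrow> nat \<Rightarrow> (nat \<Rightarrow> nat \<Rightarrow> real) \<Rightarrow> (nat \<Rightarrow> real) \<Rightarrow> nat \<Rightarrow> real" where
  "linear_coords k n M x = (\<lambda>i. if i < k then \<Sum>j<n. M i j * x j else 0)"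

lemma linear_coords_in: "linear_coords k n M x \<in> topspace (Euclidean_space k)"
  by (simp add: linear_coords_def in_Euclidean_space)

lemma bounded_coords_linear_coords:
  assumes "bounded_coords B"
  shows "bounded_coords (linear_coords k n M ` B)"
proof -
  obtain r where r: "\<And>x i. x \<in> B \<Longrightarrow> \<bar>x i\<bar> \<le> r"
    using assms unfolding bounded_coords_def by blast
  have "\<bar>linear_coords k n M x i\<bar> \<le> (\<Sum>j<n. \<bar>M i j\<bar> * r)" if "x \<in> B" "i < k" for x i
  proof -
    have "\<bar>\<Sum>j<n. M i j * x j\<bar> \<le> (\<Sum>j<n. \<bar>M i j * x j\<bar>)"
      by (rule sum_abs)
    also have "\<dots> \<le> (\<Sum>j<n. \<bar>M i j\<bar> * r)"
      using r [OF that(1)] by (intro sum_mono) (simp add: abs_mult mult_left_mono)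
    finally show ?thesis
      using that(2) by (simp add: linear_coords_def)
  qed
  then show ?thesis
    by (intro bounded_coordsI [of _ k]) (auto simp: linear_coords_in)
qed

lemma vec_Times_eq_image: "vec_Times n A B = (\<lambda>(x, y). vec_append n x y) ` (A \<times> B)"
  unfolding vec_Times_def by auto

lemma bounded_coords_vec_Times:
  assumes "bounded_coords A" "bounded_coords B"
  shows "bounded_coords (vec_Times n A B)"
proof -
  obtain r s where rs: "\<And>x i. x \<in> A \<Longrightarrow> \<bar>x i\<bar> \<le> r" "\<And>x i. x \<in> B \<Longrightarrow> \<bar>x i\<bar> \<le> s"
    using assms unfolding bounded_coords_def by blast
  have "\<bar>vec_append n x y i\<bar> \<le> max r s" if "x \<in> A" "y \<in> B" for x y i
    using rs(1) [OF that(1), of i] rs(2) [OF that(2), of "i - n"]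
    by (auto simp: vec_append_def le_max_iff_disj)
  then show ?thesis
    unfolding bounded_coords_def vec_Times_def by blast
qed

text \<open>
  The graph of a linear map is semianalytic, and the linear image is the projection of the part of the
  graph over \<open>B\<close>. This is used already for permutations of coordinates: the projections that
  define subanalytic sets only drop the last coordinates.
\<close>

lemma bounded_subanalytic_linear_image_semianalytic:
  assumes "semianalytic n B" "bounded_coords B"
  shows "bounded_subanalytic k (linear_coords k n M ` B)"
proof -
  let ?E = "topspace (Euclidean_space (k + n))"
  let ?C = "{w \<in> ?E. vec_drop k n w \<in> B} \<inter>
            {w \<in> ?E. \<forall>i\<in>{..<k}. w i - (\<Sum>j<n. M i j * w (k + j)) = 0}"
  have B: "B \<subseteq> topspace (Euclidean_space n)"
    using assms(1) by (rule semianalytic_subset)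
  have C: "?C = (\<lambda>x. vec_append k (linear_coords k n M x) x) ` B"
  proof (intro equalityI subsetI)
    fix w assume w: "w \<in> ?C"
    have "vec_take k w = linear_coords k n M (vec_drop k n w)"
      using w by (auto simp: vec_take_def linear_coords_def coord_map_def)
    then have "w = vec_append k (linear_coords k n M (vec_drop k n w)) (vec_drop k n w)"
      using w vec_append_take_drop [of w k n] by simp
    then show "w \<in> (\<lambda>x. vec_append k (linear_coords k n M x) x) ` B"
      using w by blast
  next
    fix w assume "w \<in> (\<lambda>x. vec_append k (linear_coords k n M x) x) ` B"
    then obtain x where x: "x \<in> B" "w = vec_append k (linear_coords k n M x) x"
      by blast
    moreover have "x \<in> topspace (Euclidean_space n)"
      using x B by blast
    ultimately show "w \<in> ?C"
      by (auto simp: vec_append_in vec_drop_append) (simp add: vec_append_def linear_coords_def)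
  qed
  have "bounded_subanalytic k (vec_take k ` ?C)"
  proof (rule bounded_subanalyticI)
    show "semianalytic (k + n) ?C"
      using assms(1) by (intro semianalytic_Int semianalytic_vec_drop semianalytic_equations
          real_analytic_fun_diff real_analytic_fun_sum real_analytic_fun_cmult
          real_analytic_fun_coordinate) auto
    have "bounded_coords (vec_Times k (linear_coords k n M ` B) B)"
      using assms(2) by (intro bounded_coords_vec_Times bounded_coords_linear_coords)
    then show "bounded_coords ?C"
      unfolding C by (rule bounded_coords_subset) (auto simp: vec_Times_def)
  qed
  moreover have "vec_take k ` ?C = linear_coords k n M ` B"
    unfolding C image_image using vec_take_append [OF linear_coords_in] by simp
  ultimately show ?thesis
    by simp
qed

lemma bounded_subanalytic_linear_image:
  assumes "bounded_subanalytic n A"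
  shows "bounded_subanalytic k (linear_coords k n M ` A)"
proof -
  obtain p B where B: "semianalytic (n + p) B" "bounded_coords B" "A = vec_take n ` B"
    using assms by (rule bounded_subanalyticE)
  let ?M = "\<lambda>i j. if j < n then M i j else 0"
  have sum: "(\<Sum>j<n + p. ?M i j * x j) = (\<Sum>j<n. M i j * vec_take n x j)" for i x
  proof -
    have "(\<Sum>j<n + p. ?M i j * x j) = (\<Sum>j<n. ?M i j * x j)"
      by (rule sum.mono_neutral_right) auto
    also have "\<dots> = (\<Sum>j<n. M i j * vec_take n x j)"
      by (rule sum.cong) (auto simp: vec_take_def)
    finally show ?thesis .
  qed
  have "linear_coords k n M (vec_take n x) = linear_coords k (n + p) ?M x" for x
    unfolding linear_coords_def sum ..
  then have "linear_coords k n M ` A = linear_coords k (n + p) ?M ` B"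
    unfolding B(3) image_image by simp
  then show ?thesis
    using bounded_subanalytic_linear_image_semianalytic [OF B(1,2)] by simp
qed

lemma bounded_subanalytic_coord_map:
  assumes "bounded_subanalytic n A" "\<sigma> ` {..<k} \<subseteq> {..<n}"
  shows "bounded_subanalytic k (coord_map k \<sigma> ` A)"
proof -
  have "(\<Sum>j<n. (if j = \<sigma> i then 1 else 0) * x j) = x (\<sigma> i)" if "i < k" for i and x :: "nat \<Rightarrow> real"
  proof -
    have "\<sigma> i < n"
      using assms(2) that by blast
    then show ?thesis
      by (simp add: if_distrib [of "\<lambda>a. a * _"] cong: if_cong)
  qed
  then have "coord_map k \<sigma> x = linear_coords k n (\<lambda>i j. if j = \<sigma> i then 1 else 0) x" for x
    by (auto simp: coord_map_def linear_coords_def)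
  then show ?thesis
    using bounded_subanalytic_linear_image [OF assms(1)] by simp
qed

subsection \<open>Products\<close>

lemma semianalytic_vec_Times:
  assumes "semianalytic n A" "semianalytic m B"
  shows "semianalytic (n + m) (vec_Times n A B)"
proof -
  have "vec_Times n A B = {w \<in> topspace (Euclidean_space (n + m)). vec_take n w \<in> A} \<inter>
      {w \<in> topspace (Euclidean_space (n + m)). vec_drop n m w \<in> B}"
    unfolding vec_Times_iff [OF assms [THEN semianalytic_subset]] by blast
  then show ?thesis
    using assms by (simp add: semianalytic_Int semianalytic_vec_take semianalytic_vec_drop)
qed

text \<open>
  The product of the two sets upstairs carries the auxiliary variables of the first factor in the
  middle; they are moved out of the way by the selection of coordinates \<open>\<sigma>\<close>.
\<close>

lemma bounded_subanalytic_vec_Times: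
  assumes "bounded_subanalytic n A" "bounded_subanalytic m B"
  shows "bounded_subanalytic (n + m) (vec_Times n A B)"
proof -
  obtain p A' where A': "semianalytic (n + p) A'" "bounded_coords A'" "A = vec_take n ` A'"
    using assms(1) by (rule bounded_subanalyticE)
  obtain q B' where B': "semianalytic (m + q) B'" "bounded_coords B'" "B = vec_take m ` B'"
    using assms(2) by (rule bounded_subanalyticE)
  let ?\<sigma> = "\<lambda>i. if i < n then i else p + i"
  have "bounded_subanalytic (n + p + (m + q)) (vec_Times (n + p) A' B')"
    using A' B' by (intro bounded_subanalytic_semianalytic semianalytic_vec_Times bounded_coords_vec_Times)
  then have "bounded_subanalytic (n + m) (coord_map (n + m) ?\<sigma> ` vec_Times (n + p) A' B')"
    by (rule bounded_subanalytic_coord_map) auto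
  moreover have "coord_map (n + m) ?\<sigma> (vec_append (n + p) x y) = vec_append n (vec_take n x) (vec_take m y)"
    for x y
    by (auto simp: coord_map_def vec_append_def vec_take_def fun_eq_iff)
  then have "coord_map (n + m) ?\<sigma> ` vec_Times (n + p) A' B' = vec_Times n A B"
    unfolding A'(3) B'(3) vec_Times_eq_image map_prod_surj_on [OF refl refl, symmetric]
    by (simp add: image_image split_beta)
  ultimately show ?thesis
    by simp
qed

section \<open>Bounded subanalytic relations\<close>

definition subanalytic_rel ::
    "nat \<Rightarrow> nat \<Rightarrow> ((nat \<Rightarrow> real) \<times> (nat \<Rightarrow> real)) set \<Rightarrow> bool" where
  "subanalytic_rel n m R \<longleftrightarrow>
     R \<subseteq> topspace (Euclidean_space n) \<times> topspace (Euclidean_space m) \<and>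
     bounded_subanalytic (n + m) ((\<lambda>(x, y). vec_append n x y) ` R)"

lemma subanalytic_rel_converse:
  assumes "subanalytic_rel n m R"
  shows "subanalytic_rel m n (R\<inverse>)"
proof -
  let ?\<sigma> = "\<lambda>i. if i < m then n + i else i - m"
  have R: "R \<subseteq> topspace (Euclidean_space n) \<times> topspace (Euclidean_space m)"
    using assms by (simp add: subanalytic_rel_def)
  have "bounded_subanalytic (m + n) (coord_map (m + n) ?\<sigma> ` (\<lambda>(x, y). vec_append n x y) ` R)"
    using assms by (intro bounded_subanalytic_coord_map) (auto simp: subanalytic_rel_def)
  moreover have "coord_map (m + n) ?\<sigma> (vec_append n x y) = vec_append m y x" if "(x, y) \<in> R" for x y
  proof -
    have "\<forall>i\<ge>n. x i = 0" "\<forall>i\<ge>m. y i = 0"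
      using that R by (auto simp: in_Euclidean_space)
    then show ?thesis
      by (auto simp: coord_map_def vec_append_def fun_eq_iff)
  qed
  then have "coord_map (m + n) ?\<sigma> ` (\<lambda>(x, y). vec_append n x y) ` R =
      (\<lambda>t. vec_append m (snd t) (fst t)) ` R"
    unfolding image_image by (intro image_cong) auto
  moreover have "(\<lambda>(y, x). vec_append m y x) ` (R\<inverse>) = (\<lambda>t. vec_append m (snd t) (fst t)) ` R"
    by (force simp: image_iff)
  moreover have "R\<inverse> \<subseteq> topspace (Euclidean_space m) \<times> topspace (Euclidean_space n)"
    using R by blast
  ultimately show ?thesis
    by (simp add: subanalytic_rel_def)
qed

text \<open>
  A composite is the projection of the fibre product, that is, of the part of the product on which the
  two middle variables agree.
\<close>

lemma subanalytic_rel_comp: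
  assumes "subanalytic_rel n m R" "subanalytic_rel m k S"
  shows "subanalytic_rel n k (R O S)"
proof -
  let ?\<sigma> = "\<lambda>i. if i < n then i else m + m + i"
  let ?E = "topspace (Euclidean_space (n + m + (m + k)))"
  let ?R = "(\<lambda>(x, y). vec_append n x y) ` R" and ?S = "(\<lambda>(y, z). vec_append m y z) ` S"
  let ?D = "{w \<in> ?E. \<forall>i\<in>{..<m}. w (n + i) - w (n + m + i) = 0}"
  have R: "R \<subseteq> topspace (Euclidean_space n) \<times> topspace (Euclidean_space m)"
    and S: "S \<subseteq> topspace (Euclidean_space m) \<times> topspace (Euclidean_space k)"
    using assms by (auto simp: subanalytic_rel_def)
  have "bounded_subanalytic (n + m + (m + k)) (vec_Times (n + m) ?R ?S \<inter> ?D)"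
    using assms
    by (intro bounded_subanalytic_Int bounded_subanalytic_vec_Times semianalytic_equations
        real_analytic_fun_diff real_analytic_fun_coordinate) (auto simp: subanalytic_rel_def)
  then have "bounded_subanalytic (n + k) (coord_map (n + k) ?\<sigma> ` (vec_Times (n + m) ?R ?S \<inter> ?D))"
    by (rule bounded_subanalytic_coord_map) auto
  moreover have "coord_map (n + k) ?\<sigma> ` (vec_Times (n + m) ?R ?S \<inter> ?D) =
      (\<lambda>(x, z). vec_append n x z) ` (R O S)"
  proof -
    define w where "w = (\<lambda>((x, y), (y', z)). vec_append (n + m) (vec_append n x y) (vec_append m y' z))"
    let ?T = "{t \<in> R \<times> S. snd (fst t) = fst (snd t)}"
    have *: "w ((x, y), (y', z)) \<in> ?D \<longleftrightarrow> y = y'" "coord_map (n + k) ?\<sigma> (w ((x, y), (y', z))) = vec_append n x z"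
      if xy: "(x, y) \<in> R" and yz: "(y', z) \<in> S" for x y y' z
    proof -
      have in_E: "\<forall>i\<ge>m. y i = 0" "\<forall>i\<ge>m. y' i = 0" "\<forall>i\<ge>k. z i = 0"
        using xy yz R S by (auto simp: in_Euclidean_space)
      have "w ((x, y), (y', z)) \<in> ?E"
        using xy yz R S by (auto simp: w_def intro!: vec_append_in)
      then have "w ((x, y), (y', z)) \<in> ?D \<longleftrightarrow> (\<forall>i\<in>{..<m}. y i = y' i)"
        by (simp add: vec_append_def w_def)
      also have "\<dots> \<longleftrightarrow> (\<forall>i. y i = y' i)"
        using in_E by (metis lessThan_iff not_le)
      finally show "w ((x, y), (y', z)) \<in> ?D \<longleftrightarrow> y = y'"
        by (simp add: fun_eq_iff)
      show "coord_map (n + k) ?\<sigma> (w ((x, y), (y', z))) = vec_append n x z"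
        using in_E by (auto simp: w_def coord_map_def vec_append_def fun_eq_iff)
    qed
    have "vec_Times (n + m) ?R ?S = w ` (R \<times> S)"
      unfolding vec_Times_eq_image map_prod_surj_on [OF refl refl, symmetric]
      by (simp add: image_image split_beta w_def)
    also have "w ` (R \<times> S) \<inter> ?D = w ` {t \<in> R \<times> S. w t \<in> ?D}"
      by blast
    also have "{t \<in> R \<times> S. w t \<in> ?D} = ?T"
      using *(1) by (intro Collect_cong) (simp only: mem_Times_iff split_paired_all fst_conv snd_conv cong: conj_cong)
    finally have "coord_map (n + k) ?\<sigma> ` (vec_Times (n + m) ?R ?S \<inter> ?D) =
        (\<lambda>t. coord_map (n + k) ?\<sigma> (w t)) ` ?T"
      by (simp only: image_image)
    also have "\<dots> = (\<lambda>(x, z). vec_append n x z) ` (\<lambda>t. (fst (fst t), snd (snd t))) ` ?T"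
      unfolding image_image using *(2) by (intro image_cong refl) auto
    also have "(\<lambda>t. (fst (fst t), snd (snd t))) ` ?T = R O S"
      by (force simp: image_iff)
    finally show ?thesis .
  qed
  moreover have "R O S \<subseteq> topspace (Euclidean_space n) \<times> topspace (Euclidean_space k)"
    using R S by blast
  ultimately show ?thesis
    by (simp add: subanalytic_rel_def)
qed

section \<open>Subanalytic sets are the locally bounded subanalytic ones\<close>

text \<open>
  The semianalytic set of the definition lives in \<open>M \<times> \<real>\<^sup>p\<close> only. Its closure there is compact, hence
  closed in the whole space, so that it has no points near the complement of \<open>M \<times> \<real>\<^sup>p\<close> and
  is semianalytic in the whole space.
\<close>

lemma subanalytic_in_imp_locally_bounded:
  assumes M: "openin (Euclidean_space n) M" and A: "subanalytic_in n M A" and a: "a \<in> M"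
  obtains U where "openin (Euclidean_space n) U" "a \<in> U" "bounded_subanalytic n (A \<inter> U)"
proof -
  have "\<exists>U p B. openin (subspace_of n M) U \<and> a \<in> U \<and>
        (let N = vec_Times n M (topspace (Euclidean_space p)); T = subspace_of (n + p) N in
           semianalytic_in (n + p) N B \<and> compactin T (T closure_of B)) \<and>
        A \<inter> U = vec_take n ` B"
    using A a unfolding subanalytic_in_def by (elim conjE) (erule bspec)
  then obtain U p B where U: "openin (subspace_of n M) U" "a \<in> U" "A \<inter> U = vec_take n ` B"
    and B: "semianalytic_in (n + p) (vec_Times n M (topspace (Euclidean_space p))) B"
      "compactin (subspace_of (n + p) (vec_Times n M (topspace (Euclidean_space p))))
        (subspace_of (n + p) (vec_Times n M (topspace (Euclidean_space p))) closure_of B)"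
    unfolding Let_def by (elim exE conjE)
  define N where "N = vec_Times n M (topspace (Euclidean_space p))"
  define K where "K = subspace_of (n + p) N closure_of B"
  have N: "openin (Euclidean_space (n + p)) N"
    unfolding N_def using M by (intro openin_vec_Times) auto
  have B_N: "B \<subseteq> N"
    using B(1) by (simp add: semianalytic_in_def N_def)
  have K: "compactin (Euclidean_space (n + p)) K"
    using B(2) unfolding K_def N_def compactin_subtopology by blast
  have N_top: "N \<subseteq> topspace (Euclidean_space (n + p))"
    using N openin_subset by blast
  have B_K: "B \<subseteq> K"
    unfolding K_def using B_N N_top by (intro closure_of_subset) auto
  have "semianalytic (n + p) B"
  proof (rule semianalyticI)
    show "B \<subseteq> topspace (Euclidean_space (n + p))"
      using B_N N_top by blast
    fix w assume w: "w \<in> topspace (Euclidean_space (n + p))"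
    show "\<exists>V. openin (Euclidean_space (n + p)) V \<and> w \<in> V \<and> semianalytic_on (n + p) V B"
    proof (cases "w \<in> N")
      case True
      then obtain V where "openin (subspace_of (n + p) N) V" "w \<in> V" "semianalytic_on (n + p) V B"
        using B(1) unfolding semianalytic_in_iff N_def by blast
      then show ?thesis
        using N openin_trans_full by blast
    next
      case False
      have "w \<notin> K"
        using False B(2) compactin_subset_topspace unfolding K_def N_def by fastforce
      moreover have "openin (Euclidean_space (n + p)) (topspace (Euclidean_space (n + p)) - K)"
        using compactin_imp_closedin [OF Hausdorff_Euclidean_space K] by blast
      moreover have "semianalytic_on (n + p) (topspace (Euclidean_space (n + p)) - K) B"
        using B_K by (intro semianalytic_on_empty) blast
      ultimately show ?thesis
        using w by blast
    qed
  qed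
  moreover have "bounded_coords B"
    using bounded_coords_compactin [OF K] B_K by (rule bounded_coords_subset)
  ultimately have "bounded_subanalytic n (A \<inter> U)"
    unfolding U(3) by (rule bounded_subanalyticI)
  moreover have "openin (Euclidean_space n) U"
    using U(1) M openin_trans_full by blast
  ultimately show thesis
    using that U(2) by blast
qed

lemma locally_bounded_imp_subanalytic_in:
  assumes A: "A \<subseteq> topspace (Euclidean_space n)"
    and loc: "\<And>a. a \<in> topspace (Euclidean_space n) \<Longrightarrow>
        \<exists>U. openin (Euclidean_space n) U \<and> a \<in> U \<and> bounded_subanalytic n (A \<inter> U)"
  shows "subanalytic_in n (topspace (Euclidean_space n)) A"
  unfolding subanalytic_in_def vec_Times_Euclidean_space subtopology_topspace Let_def
proof (intro conjI ballI A)
  fix a assume "a \<in> topspace (Euclidean_space n)"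
  then obtain U where U: "openin (Euclidean_space n) U" "a \<in> U" "bounded_subanalytic n (A \<inter> U)"
    using loc by blast
  obtain p B where B: "semianalytic (n + p) B" "bounded_coords B" "A \<inter> U = vec_take n ` B"
    using U(3) by (rule bounded_subanalyticE)
  obtain r where "B \<subseteq> closed_box (n + p) (\<lambda>i. 0) r"
    using bounded_coords_closed_box [OF semianalytic_subset [OF B(1)] B(2)] by blast
  then have "Euclidean_space (n + p) closure_of B \<subseteq> closed_box (n + p) (\<lambda>i. 0) r"
    by (simp add: closure_of_minimal closedin_closed_box)
  then have "compactin (Euclidean_space (n + p)) (Euclidean_space (n + p) closure_of B)"
    using compactin_closed_box closed_compactin closedin_closure_of by blast
  then show "\<exists>U p B. openin (Euclidean_space n) U \<and> a \<in> U \<and>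
      (semianalytic (n + p) B \<and>
       compactin (Euclidean_space (n + p)) (Euclidean_space (n + p) closure_of B)) \<and>
      A \<inter> U = vec_take n ` B"
    using U B by blast
qed

section \<open>Graphs\<close>

lemma subanalytic_relI:
  assumes "R \<subseteq> topspace (Euclidean_space n) \<times> topspace (Euclidean_space m)"
    and "bounded_subanalytic (n + m) A" "(\<lambda>(x, y). vec_append n x y) ` R = A"
  shows "subanalytic_rel n m R"
  using assms by (simp add: subanalytic_rel_def)

lemma subanalytic_rel_UN:
  assumes "finite I" "\<And>i. i \<in> I \<Longrightarrow> subanalytic_rel n m (R i)"
  shows "subanalytic_rel n m (\<Union>i\<in>I. R i)"
  unfolding subanalytic_rel_def image_UN
  using assms by (auto simp: subanalytic_rel_def intro!: bounded_subanalytic_UN)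

text \<open>
  The graph over a closed box inside the open domain is semianalytic in the whole space: away from the
  closed box it is locally empty, and over the domain it is given by the inequalities of the box and the
  equations \<open>y\<^sub>i = f\<^sub>i x\<close>, whose sides are analytic functions of separate variables.
\<close>

lemma subanalytic_rel_graph:
  assumes U: "openin (Euclidean_space n) U" and f: "real_analytic_map n m U f"
    and box: "closed_box n a r \<subseteq> U" and bounded: "bounded_coords (f ` closed_box n a r)"
  shows "subanalytic_rel n m ((\<lambda>x. (x, f x)) ` closed_box n a r)"
proof (rule subanalytic_relI)
  let ?E = "topspace (Euclidean_space (n + m))"
  let ?B = "{w \<in> ?E. vec_take n w \<in> closed_box n a r}"
  let ?Q = "{w. \<forall>i\<in>{..<m}. w (n + i) - f (vec_take n w) i = 0}"
  have f_in: "f x \<in> topspace (Euclidean_space m)" if "x \<in> U" for x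
    using f that by (auto simp: real_analytic_map_def)
  have box_E: "closed_box n a r \<subseteq> topspace (Euclidean_space n)"
    by (auto simp: closed_box_def)
  show "(\<lambda>x. (x, f x)) ` closed_box n a r \<subseteq> topspace (Euclidean_space n) \<times> topspace (Euclidean_space m)"
    using box box_E f_in by auto
  have B: "semianalytic (n + m) ?B"
    by (intro semianalytic_vec_take semianalytic_closed_box) simp
  have "semianalytic (n + m) (?B \<inter> ?Q)"
  proof (rule semianalyticI)
    fix w assume w: "w \<in> ?E"
    show "\<exists>V. openin (Euclidean_space (n + m)) V \<and> w \<in> V \<and> semianalytic_on (n + m) V (?B \<inter> ?Q)"
    proof (cases "vec_take n w \<in> U")
      case True
      let ?V = "{w \<in> ?E. vec_take n w \<in> U}"
      obtain W where W: "openin (Euclidean_space (n + m)) W" "w \<in> W" "semianalytic_on (n + m) W ?B"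
        using semianalyticD [OF B w] .
      have "real_analytic_fun (n + m) ?V (\<lambda>w. f (vec_take n w) i)" if "i < m" for i
        unfolding vec_take_eq_coord_map
        using f that by (intro real_analytic_fun_coord_map [of n U "\<lambda>x. f x i"])
          (auto simp: real_analytic_map_def)
      then have "semianalytic_on (n + m) ?V ?Q"
        by (intro semianalytic_on_Ball semianalytic_on_zero real_analytic_fun_diff
            real_analytic_fun_coordinate) auto
      then have "semianalytic_on (n + m) (W \<inter> ?V) (?B \<inter> ?Q)"
        using W(3) by (intro semianalytic_on_Int) (auto elim: semianalytic_on_subset)
      moreover have "openin (Euclidean_space (n + m)) (W \<inter> ?V)"
        using W(1) U by (intro openin_Int openin_vec_take_preimage)
      ultimately show ?thesis
        using W(2) w True by blast
    next
      case False
      let ?V = "{w \<in> ?E. vec_take n w \<in> topspace (Euclidean_space n) - closed_box n a r}"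
      have "openin (Euclidean_space (n + m)) ?V"
        by (intro openin_vec_take_preimage openin_diff closedin_closed_box openin_topspace)
      moreover have "semianalytic_on (n + m) ?V (?B \<inter> ?Q)"
        by (intro semianalytic_on_empty) blast
      moreover have "w \<in> ?V"
        using w False box by auto
      ultimately show ?thesis
        by blast
    qed
  qed blast
  moreover have graph: "(\<lambda>(x, y). vec_append n x y) ` (\<lambda>x. (x, f x)) ` closed_box n a r = ?B \<inter> ?Q"
  proof (intro equalityI subsetI)
    fix w assume "w \<in> (\<lambda>(x, y). vec_append n x y) ` (\<lambda>x. (x, f x)) ` closed_box n a r"
    then obtain x where x: "x \<in> closed_box n a r" "w = vec_append n x (f x)"
      by auto
    then have "vec_take n w = x" "w \<in> ?E"
      using box box_E f_in by (auto intro!: vec_take_append vec_append_in)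
    then show "w \<in> ?B \<inter> ?Q"
      using x by (simp add: vec_append_def)
  next
    fix w assume w: "w \<in> ?B \<inter> ?Q"
    then have "vec_take n w \<in> U"
      using box by blast
    from f_in [OF this] have "vec_drop n m w = f (vec_take n w)"
      using w by (auto simp: coord_map_def in_Euclidean_space fun_eq_iff)
    then have "w = vec_append n (vec_take n w) (f (vec_take n w))"
      using w vec_append_take_drop [of w n m] by simp
    then show "w \<in> (\<lambda>(x, y). vec_append n x y) ` (\<lambda>x. (x, f x)) ` closed_box n a r"
      using w by (simp add: image_image)
  qed
  moreover have "bounded_coords (?B \<inter> ?Q)"
  proof (rule bounded_coords_subset)
    show "bounded_coords (vec_Times n (closed_box n a r) (f ` closed_box n a r))"
      using bounded_coords_compactin [OF compactin_closed_box] bounded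
      by (rule bounded_coords_vec_Times)
    show "?B \<inter> ?Q \<subseteq> vec_Times n (closed_box n a r) (f ` closed_box n a r)"
      unfolding graph [symmetric] vec_Times_eq_image by auto
  qed
  ultimately show "bounded_subanalytic (n + m) (?B \<inter> ?Q)"
    by (intro bounded_subanalytic_semianalytic)
  show "(\<lambda>(x, y). vec_append n x y) ` (\<lambda>x. (x, f x)) ` closed_box n a r = ?B \<inter> ?Q"
    by (rule graph)
qed

section \<open>Linear simplices\<close>

definition standard_simplex :: "nat \<Rightarrow> (nat \<Rightarrow> real) set" where
  "standard_simplex l = {x \<in> topspace (Euclidean_space l). (\<forall>j<l. 0 \<le> x j) \<and> (\<Sum>j<l. x j) = 1}"

lemma bounded_subanalytic_standard_simplex: "bounded_subanalytic l (standard_simplex l)"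
proof (rule bounded_subanalytic_semianalytic)
  let ?E = "topspace (Euclidean_space l)"
  have "semianalytic l ({x \<in> ?E. \<forall>j\<in>{..<l}. x j \<ge> 0} \<inter> {x \<in> ?E. \<forall>i\<in>{0::nat}. (\<Sum>j<l. x j) - 1 = 0})"
    by (intro semianalytic_Int semianalytic_equations semianalytic_inequalities real_analytic_fun_diff
        real_analytic_fun_sum real_analytic_fun_coordinate real_analytic_fun_const) auto
  moreover have "standard_simplex l =
      {x \<in> ?E. \<forall>j\<in>{..<l}. x j \<ge> 0} \<inter> {x \<in> ?E. \<forall>i\<in>{0::nat}. (\<Sum>j<l. x j) - 1 = 0}"
    by (auto simp: standard_simplex_def)
  ultimately show "semianalytic l (standard_simplex l)"
    by simp
  show "bounded_coords (standard_simplex l)"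
  proof (rule bounded_coordsI [of _ l])
    fix i assume i: "i < l"
    have "\<bar>x i\<bar> \<le> 1" if x: "x \<in> standard_simplex l" for x
    proof -
      have "x i \<le> (\<Sum>j<l. x j)"
        using x i by (intro member_le_sum) (auto simp: standard_simplex_def)
      then show ?thesis
        using x i by (simp add: standard_simplex_def)
    qed
    then show "\<exists>r. \<forall>x\<in>standard_simplex l. \<bar>x i\<bar> \<le> r"
      by blast
  qed (auto simp: standard_simplex_def)
qed

text \<open>
  The points of a simplex are linear images of their barycentric coordinates, which run through the standard
  simplex; so is the pair of the images under two linear maps.
\<close>

lemma subanalytic_rel_simplex:
  fixes p q :: "'v \<Rightarrow> nat \<Rightarrow> real"
  assumes s: "finite s"
    and p: "\<And>v. v \<in> s \<Longrightarrow> p v \<in> topspace (Euclidean_space m)"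
    and q: "\<And>v. v \<in> s \<Longrightarrow> q v \<in> topspace (Euclidean_space k)"
  shows "subanalytic_rel m k ((\<lambda>b. (\<lambda>i. \<Sum>v\<in>s. b v * p v i, \<lambda>i. \<Sum>v\<in>s. b v * q v i)) ` closed_simplex s)"
proof -
  define l where "l = card s"
  obtain h where h: "bij_betw h {..<l} s"
    using ex_bij_betw_nat_finite [OF s] by (auto simp: l_def atLeast0LessThan)
  define enc where "enc = (\<lambda>(b :: 'v \<Rightarrow> real) j. if j < l then b (h j) else 0)"
  let ?M = "\<lambda>i j. if i < m then p (h j) i else q (h j) (i - m)"
  have reindex: "(\<Sum>v\<in>s. g v) = (\<Sum>j<l. g (h j))" for g :: "'v \<Rightarrow> real"
    using sum.reindex_bij_betw [OF h, of g] by simp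
  have h_in: "h j \<in> s" if "j < l" for j
    using h that by (auto simp: bij_betw_def)
  have enc: "enc ` closed_simplex s = standard_simplex l"
  proof (intro equalityI subsetI)
    fix x assume "x \<in> enc ` closed_simplex s"
    then show "x \<in> standard_simplex l"
      by (auto simp: enc_def closed_simplex_def standard_simplex_def in_Euclidean_space reindex)
  next
    fix x assume x: "x \<in> standard_simplex l"
    define b where "b = (\<lambda>v. if v \<in> s then x (the_inv_into {..<l} h v) else 0)"
    have b_h: "b (h j) = x j" if "j < l" for j
      using that h h_in by (simp add: b_def bij_betw_def the_inv_into_f_f)
    have "enc b = x"
      using x b_h by (auto simp: enc_def standard_simplex_def in_Euclidean_space)
    moreover have "b \<in> closed_simplex s"
    proof -
      have "0 \<le> b v" for v
      proof (cases "v \<in> s")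
        case True
        then obtain j where "j < l" "v = h j"
          using h by (auto simp: bij_betw_def)
        then show ?thesis
          using x b_h by (simp add: standard_simplex_def)
      qed (simp add: b_def)
      moreover have "sum b s = 1"
        using x b_h by (simp add: reindex standard_simplex_def)
      ultimately show ?thesis
        by (simp add: closed_simplex_def b_def)
    qed
    ultimately show "x \<in> enc ` closed_simplex s"
      by blast
  qed
  have zero: "(\<Sum>v\<in>s. b v * p v i) = 0" if "m \<le> i" for b i
    using p that by (intro sum.neutral) (simp add: in_Euclidean_space)
  have zero': "(\<Sum>v\<in>s. b v * q v i) = 0" if "k \<le> i" for b i
    using q that by (intro sum.neutral) (simp add: in_Euclidean_space)
  have lin: "linear_coords (m + k) l ?M (enc b) =
      vec_append m (\<lambda>i. \<Sum>v\<in>s. b v * p v i) (\<lambda>i. \<Sum>v\<in>s. b v * q v i)" for b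
  proof
    fix i
    have "linear_coords (m + k) l ?M (enc b) i = (\<Sum>j<l. ?M i j * b (h j))" if "i < m + k"
      using that by (auto simp: linear_coords_def enc_def intro!: sum.cong)
    then show "linear_coords (m + k) l ?M (enc b) i =
        vec_append m (\<lambda>i. \<Sum>v\<in>s. b v * p v i) (\<lambda>i. \<Sum>v\<in>s. b v * q v i) i"
      using zero' [of "i - m" b]
      by (cases "i < m + k") (auto simp: linear_coords_def vec_append_def reindex mult.commute)
  qed
  show ?thesis
  proof (rule subanalytic_relI)
    show "bounded_subanalytic (m + k) (linear_coords (m + k) l ?M ` standard_simplex l)"
      by (intro bounded_subanalytic_linear_image bounded_subanalytic_standard_simplex)
    show "(\<lambda>(x, y). vec_append m x y) `
        (\<lambda>b. (\<lambda>i. \<Sum>v\<in>s. b v * p v i, \<lambda>i. \<Sum>v\<in>s. b v * q v i)) ` closed_simplex s =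
        linear_coords (m + k) l ?M ` standard_simplex l"
      unfolding enc [symmetric] image_image lin by simp
  qed (auto simp: in_Euclidean_space zero zero')
qed

section \<open>Correspondences between charts\<close>

text \<open>
  For the graph of a function this is continuity at \<open>u\<close>, together with the domain being a
  neighbourhood of \<open>u\<close>.
\<close>

definition lower_semicontinuous_at ::
    "nat \<Rightarrow> nat \<Rightarrow> ((nat \<Rightarrow> real) \<times> (nat \<Rightarrow> real)) set \<Rightarrow> (nat \<Rightarrow> real) \<Rightarrow> (nat \<Rightarrow> real) \<Rightarrow> bool" where
  "lower_semicontinuous_at n m R u v \<longleftrightarrow>
     (\<forall>N. openin (Euclidean_space m) N \<and> v \<in> N \<longrightarrow>
        (\<exists>D. openin (Euclidean_space n) D \<and> u \<in> D \<and> (\<forall>x\<in>D. \<exists>y\<in>N. (x, y) \<in> R)))"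

lemma lower_semicontinuous_atD:
  assumes "lower_semicontinuous_at n m R u v" "openin (Euclidean_space m) N" "v \<in> N"
  obtains D where "openin (Euclidean_space n) D" "u \<in> D" "\<And>x. x \<in> D \<Longrightarrow> \<exists>y\<in>N. (x, y) \<in> R"
proof -
  have "\<exists>D. openin (Euclidean_space n) D \<and> u \<in> D \<and> (\<forall>x\<in>D. \<exists>y\<in>N. (x, y) \<in> R)"
    using assms(1) [unfolded lower_semicontinuous_at_def, rule_format, OF conjI [OF assms(2,3)]] .
  then show thesis
    using that by (elim exE conjE) (simp only: Ball_def)
qed

lemma lower_semicontinuous_at_comp:
  assumes R: "lower_semicontinuous_at n m R u v" and S: "lower_semicontinuous_at m k S v w"
  shows "lower_semicontinuous_at n k (R O S) u w"
  unfolding lower_semicontinuous_at_def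
proof (intro allI impI)
  fix N assume "openin (Euclidean_space k) N \<and> w \<in> N"
  then obtain D where D: "openin (Euclidean_space m) D" "v \<in> D" "\<And>y. y \<in> D \<Longrightarrow> \<exists>z\<in>N. (y, z) \<in> S"
    using lower_semicontinuous_atD [OF S, of N] by blast
  obtain D' where D': "openin (Euclidean_space n) D'" "u \<in> D'" "\<And>x. x \<in> D' \<Longrightarrow> \<exists>y\<in>D. (x, y) \<in> R"
    using lower_semicontinuous_atD [OF R D(1,2)] by blast
  have "\<exists>z\<in>N. (x, z) \<in> R O S" if "x \<in> D'" for x
    using D(3) D'(3) [OF that] by blast
  then show "\<exists>D. openin (Euclidean_space n) D \<and> u \<in> D \<and> (\<forall>x\<in>D. \<exists>z\<in>N. (x, z) \<in> R O S)"
    using D'(1,2) by blast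
qed

text \<open>
  The germ of a change of charts as a relation. It is symmetric in the two charts, which
  makes it usable for chains of embeddings in both directions.
\<close>

definition chart_correspondence ::
    "nat \<Rightarrow> ('g, 'a) orbifold_chart \<Rightarrow> (nat \<Rightarrow> real) \<Rightarrow>
     ('h, 'a) orbifold_chart \<Rightarrow> (nat \<Rightarrow> real) \<Rightarrow> bool" where
  "chart_correspondence n c u d v \<longleftrightarrow>
     (\<exists>R. subanalytic_rel n n R \<and>
        R \<subseteq> {(x, y). x \<in> chart_dom c \<and> y \<in> chart_dom d \<and> chart_map c x = chart_map d y} \<and>
        lower_semicontinuous_at n n R u v \<and> lower_semicontinuous_at n n (R\<inverse>) v u)"

lemma chart_correspondence_sym:
  assumes "chart_correspondence n c u d v"
  shows "chart_correspondence n d v c u"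
proof -
  obtain R where R: "subanalytic_rel n n R"
    "R \<subseteq> {(x, y). x \<in> chart_dom c \<and> y \<in> chart_dom d \<and> chart_map c x = chart_map d y}"
    "lower_semicontinuous_at n n R u v" "lower_semicontinuous_at n n (R\<inverse>) v u"
    using assms unfolding chart_correspondence_def by blast
  have "R\<inverse> \<subseteq> {(y, x). y \<in> chart_dom d \<and> x \<in> chart_dom c \<and> chart_map d y = chart_map c x}"
    using R(2) by fastforce
  then show ?thesis
    unfolding chart_correspondence_def using R subanalytic_rel_converse [OF R(1)]
    by (intro exI [of _ "R\<inverse>"]) simp
qed

lemma chart_correspondence_trans:
  assumes "chart_correspondence n c u d v" "chart_correspondence n d v b w"
  shows "chart_correspondence n c u b w"
proof -
  obtain R where R: "subanalytic_rel n n R"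
    "R \<subseteq> {(x, y). x \<in> chart_dom c \<and> y \<in> chart_dom d \<and> chart_map c x = chart_map d y}"
    "lower_semicontinuous_at n n R u v" "lower_semicontinuous_at n n (R\<inverse>) v u"
    using assms(1) unfolding chart_correspondence_def by blast
  obtain S where S: "subanalytic_rel n n S"
    "S \<subseteq> {(x, y). x \<in> chart_dom d \<and> y \<in> chart_dom b \<and> chart_map d x = chart_map b y}"
    "lower_semicontinuous_at n n S v w" "lower_semicontinuous_at n n (S\<inverse>) w v"
    using assms(2) unfolding chart_correspondence_def by blast
  have "R O S \<subseteq> {(x, y). x \<in> chart_dom c \<and> y \<in> chart_dom b \<and> chart_map c x = chart_map b y}"
    using R(2) S(2) by fastforce
  then show ?thesis
    unfolding chart_correspondence_def
    using subanalytic_rel_comp [OF R(1) S(1)] lower_semicontinuous_at_comp [OF R(3) S(3)]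
      lower_semicontinuous_at_comp [OF S(4) R(4)]
    by (intro exI [of _ "R O S"]) (simp add: converse_relcomp)
qed

text \<open>
  The graph of \<open>f\<close> over a box around \<open>u\<close> is a correspondence: it is lower semicontinuous since \<open>f\<close> is
  continuous, and so is its converse since \<open>f\<close> is open.
\<close>

lemma chart_correspondence_analytic:
  assumes U: "openin (Euclidean_space n) U" and V: "openin (Euclidean_space n) V"
    and homeo: "homeomorphic_map (subspace_of n U) (subspace_of n V) f"
    and analytic: "real_analytic_map n n U f" and u: "u \<in> U"
    and c: "U \<subseteq> chart_dom c" and d: "V \<subseteq> chart_dom d"
    and eq: "\<And>x. x \<in> U \<Longrightarrow> chart_map d (f x) = chart_map c x"
  shows "chart_correspondence n c u d (f u)"
proof -
  have cont: "continuous_map (subspace_of n U) (Euclidean_space n) f"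
    using homeo homeomorphic_imp_continuous_map continuous_map_in_subtopology by blast
  have f_V: "f x \<in> V" if "x \<in> U" for x
    using homeomorphic_imp_surjective_map [OF homeo] openin_subset [OF U] openin_subset [OF V] that
    by auto
  have preimage: "openin (Euclidean_space n) {x \<in> U. f x \<in> N}" if "openin (Euclidean_space n) N" for N
  proof -
    have "openin (subspace_of n U) {x \<in> topspace (subspace_of n U). f x \<in> N}"
      using cont that by (rule openin_continuous_map_preimage)
    moreover have "{x \<in> topspace (subspace_of n U). f x \<in> N} = {x \<in> U. f x \<in> N}"
      using openin_subset [OF U] by auto
    ultimately show ?thesis
      using openin_trans_full [OF _ U] by simp
  qed
  have image: "openin (Euclidean_space n) (f ` D)" if "openin (Euclidean_space n) D" "D \<subseteq> U" for D
  proof -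
    have "openin (subspace_of n V) (f ` D)"
      using homeomorphic_imp_open_map [OF homeo] that
      by (simp add: open_map_def openin_open_subtopology U)
    then show ?thesis
      using openin_trans_full [OF _ V] by blast
  qed
  have u_E: "u \<in> topspace (Euclidean_space n)" and fu_E: "f u \<in> topspace (Euclidean_space n)"
    using u f_V [OF u] openin_subset [OF U] openin_subset [OF V] by auto
  \<comment> \<open>The unit box around \<open>f u\<close> is there to keep the graph bounded.\<close>
  let ?N = "{x \<in> U. f x \<in> open_box n (f u) 1}"
  have "openin (Euclidean_space n) ?N" "u \<in> ?N"
    using preimage openin_open_box u centre_in_open_box [OF fu_E] by auto
  then obtain r where r: "0 < r" "closed_box n u r \<subseteq> ?N"
    by (rule closed_box_in_open)
  let ?R = "(\<lambda>x. (x, f x)) ` closed_box n u r"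
  let ?B = "open_box n u r"
  have B: "openin (Euclidean_space n) ?B" "u \<in> ?B" "?B \<subseteq> closed_box n u r" "?B \<subseteq> U"
    using openin_open_box centre_in_open_box [OF u_E r(1)] open_box_subset_closed_box r(2) by blast+
  have "f ` closed_box n u r \<subseteq> closed_box n (f u) 1"
    using r(2) open_box_subset_closed_box by blast
  then have "bounded_coords (f ` closed_box n u r)"
    using bounded_coords_compactin [OF compactin_closed_box] bounded_coords_subset by blast
  then have "subanalytic_rel n n ?R"
    using U analytic r(2) by (intro subanalytic_rel_graph [of n U]) auto
  moreover have "?R \<subseteq> {(x, y). x \<in> chart_dom c \<and> y \<in> chart_dom d \<and> chart_map c x = chart_map d y}"
    using r(2) c d f_V eq by fastforce
  moreover have "lower_semicontinuous_at n n ?R u (f u)"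
    unfolding lower_semicontinuous_at_def
  proof (intro allI impI)
    fix N assume N: "openin (Euclidean_space n) N \<and> f u \<in> N"
    let ?D = "{x \<in> U. f x \<in> N} \<inter> ?B"
    have "openin (Euclidean_space n) ?D" "u \<in> ?D"
      using N B u preimage by (auto intro: openin_Int)
    moreover have "\<forall>x\<in>?D. \<exists>y\<in>N. (x, y) \<in> ?R"
      using B(3) by blast
    ultimately show "\<exists>D. openin (Euclidean_space n) D \<and> u \<in> D \<and> (\<forall>x\<in>D. \<exists>y\<in>N. (x, y) \<in> ?R)"
      by blast
  qed
  moreover have "lower_semicontinuous_at n n (?R\<inverse>) (f u) u"
    unfolding lower_semicontinuous_at_def
  proof (intro allI impI)
    fix N assume N: "openin (Euclidean_space n) N \<and> u \<in> N"
    let ?D = "f ` (N \<inter> ?B)"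
    have "openin (Euclidean_space n) ?D" "f u \<in> ?D"
      using N B by (auto intro!: image openin_Int)
    moreover have "\<forall>y\<in>?D. \<exists>x\<in>N. (y, x) \<in> ?R\<inverse>"
      using B(3) by blast
    ultimately show "\<exists>D. openin (Euclidean_space n) D \<and> f u \<in> D \<and> (\<forall>y\<in>D. \<exists>x\<in>N. (y, x) \<in> ?R\<inverse>)"
      by blast
  qed
  ultimately show ?thesis
    unfolding chart_correspondence_def by blast
qed

section \<open>Charts of an orbifold correspond over common points\<close>

lemma analytic_chart_open:
  assumes "analytic_chart n X c"
  shows "openin (Euclidean_space n) (chart_dom c)" "openin X (chart_image c)"
  using assms by (auto simp: analytic_chart_def orbifold_chart_def)

lemma chart_correspondence_embedding:
  assumes b: "analytic_chart n X b" and emb: "embeds_analytically n b c" and u: "u \<in> chart_dom b"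
  obtains v where "v \<in> chart_dom c" "chart_map c v = chart_map b u" "chart_correspondence n b u c v"
proof -
  obtain l h where l: "embedding_map (subspace_of n (chart_dom b)) (subspace_of n (chart_dom c)) l"
      "\<And>x. x \<in> chart_dom b \<Longrightarrow> chart_map c (l x) = chart_map b x"
    and an: "real_analytic_embedding n (chart_dom b) (chart_dom c) l"
    using emb by (auto simp: embeds_analytically_def chart_embedding_def)
  have U: "openin (Euclidean_space n) (chart_dom b)"
    using b by (rule analytic_chart_open)
  have sub: "l ` chart_dom b \<subseteq> chart_dom c" and V: "openin (Euclidean_space n) (l ` chart_dom b)"
    and map: "real_analytic_map n n (chart_dom b) l"
    using an by (auto simp: real_analytic_embedding_def real_analytic_diffeo_def)
  have "topspace (subspace_of n (chart_dom b)) = chart_dom b"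
    using openin_subset [OF U] by auto
  then have "homeomorphic_map (subspace_of n (chart_dom b)) (subspace_of n (l ` chart_dom b)) l"
    using l(1) sub by (simp add: embedding_map_def subtopology_subtopology Int_absorb1)
  then have "chart_correspondence n b u c (l u)"
    using U V map u sub l(2) by (intro chart_correspondence_analytic) auto
  then show thesis
    using that sub u l(2) by blast
qed

text \<open>
  Two points of one chart over the same point of \<open>X\<close> are exchanged by an element of the chart group,
  which acts analytically.
\<close>

lemma chart_correspondence_same_chart:
  assumes c: "analytic_chart n X c" and uv: "u \<in> chart_dom c" "v \<in> chart_dom c"
    and eq: "chart_map c u = chart_map c v"
  shows "chart_correspondence n c u c v"
proof -
  have U: "openin (Euclidean_space n) (chart_dom c)"
    using c by (rule analytic_chart_open)
  have orbit: "chart_map c x = chart_map c y \<longleftrightarrow> y \<in> orbit (chart_group c) (chart_act c) x"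
    if "x \<in> chart_dom c" "y \<in> chart_dom c" for x y
    using c that by (simp add: analytic_chart_def orbifold_chart_def)
  obtain g where g: "g \<in> carrier (chart_group c)" "chart_act c g u = v"
    using orbit [OF uv] eq by (auto simp: orbit_def)
  have homeo: "homeomorphic_map (subspace_of n (chart_dom c)) (subspace_of n (chart_dom c)) (chart_act c g)"
    and an: "real_analytic_map n n (chart_dom c) (chart_act c g)"
    and bij: "bij_betw (chart_act c g) (chart_dom c) (chart_dom c)"
    using c g(1) by (auto simp: analytic_chart_def orbifold_chart_def real_analytic_diffeo_def)
  have "chart_map c (chart_act c g x) = chart_map c x" if "x \<in> chart_dom c" for x
  proof -
    have "chart_act c g x \<in> chart_dom c"
      using bij that by (auto simp: bij_betw_def)
    then show ?thesis
      using orbit [of x "chart_act c g x"] that g(1) by (auto simp: orbit_def)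
  qed
  then have "chart_correspondence n c u c (chart_act c g u)"
    using U homeo an uv by (intro chart_correspondence_analytic) auto
  then show ?thesis
    by (simp add: g(2))
qed

definition coherent_charts :: "nat \<Rightarrow> ('g, 'a) orbifold_chart set \<Rightarrow> ('g, 'a) orbifold_chart set \<Rightarrow> bool" where
  "coherent_charts n \<A> \<B> \<longleftrightarrow> (\<forall>c\<in>\<A>. \<forall>d\<in>\<B>. \<forall>u\<in>chart_dom c. \<forall>v\<in>chart_dom d.
     chart_map c u = chart_map d v \<longrightarrow> chart_correspondence n c u d v)"

lemma coherent_chartsD:
  assumes "coherent_charts n \<A> \<B>" "c \<in> \<A>" "d \<in> \<B>" "u \<in> chart_dom c" "v \<in> chart_dom d"
    "chart_map c u = chart_map d v"
  shows "chart_correspondence n c u d v"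
  using assms by (simp add: coherent_charts_def)

lemma in_chart_imageE:
  assumes "x \<in> chart_image c"
  obtains u where "u \<in> chart_dom c" "chart_map c u = x"
  using assms by (auto simp: chart_image_def)

lemma coherent_charts_atlas:
  assumes \<A>: "analytic_atlas n X \<A>"
  shows "coherent_charts n \<A> \<A>"
  unfolding coherent_charts_def
proof (intro ballI impI)
  fix c d u v
  assume cd: "c \<in> \<A>" "d \<in> \<A>" and uv: "u \<in> chart_dom c" "v \<in> chart_dom d"
    and eq: "chart_map c u = chart_map d v"
  have ch: "analytic_chart n X c" "analytic_chart n X d"
    using \<A> cd by (auto simp: analytic_atlas_def)
  have "chart_map c u \<in> chart_image c \<inter> chart_image d"
    using uv eq unfolding chart_image_def by (metis IntI image_eqI)
  then obtain b where b: "b \<in> \<A>" "chart_map c u \<in> chart_image b"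
      "embeds_analytically n b c" "embeds_analytically n b d"
    using \<A> cd unfolding analytic_atlas_def by blast
  have b': "analytic_chart n X b"
    using \<A> b(1) by (auto simp: analytic_atlas_def)
  obtain w where w: "w \<in> chart_dom b" "chart_map b w = chart_map c u"
    using b(2) by (rule in_chart_imageE)
  obtain u' where u': "u' \<in> chart_dom c" "chart_map c u' = chart_map b w" "chart_correspondence n b w c u'"
    using chart_correspondence_embedding [OF b' b(3) w(1)] .
  obtain v' where v': "v' \<in> chart_dom d" "chart_map d v' = chart_map b w" "chart_correspondence n b w d v'"
    using chart_correspondence_embedding [OF b' b(4) w(1)] .
  have "chart_correspondence n c u c u'"
    using ch(1) uv(1) u'(1,2) w(2) by (intro chart_correspondence_same_chart) simp_all
  moreover have "chart_correspondence n d v' d v"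
    using ch(2) uv(2) v'(1,2) w(2) eq by (intro chart_correspondence_same_chart) simp_all
  ultimately show "chart_correspondence n c u d v"
    using chart_correspondence_sym [OF u'(3)] v'(3) by (meson chart_correspondence_trans)
qed

text \<open>
  A chart \<open>b\<close> of the common refinement embeds into some chart of either atlas, and within each atlas that chart
  corresponds to the given one. Coherence is assumed for \<open>\<A>\<close> instead of \<open>\<A>\<close> being an
  atlas in order to cover the single chart of \<open>\<real>\<^sup>m\<close>.
\<close>

lemma coherent_charts_equivalent:
  assumes equiv: "atlas_equivalent n X \<A> \<B>" and \<B>: "analytic_atlas n X \<B>"
    and coh: "coherent_charts n \<A> \<A>"
  shows "coherent_charts n \<A> \<B>"
  unfolding coherent_charts_def
proof (intro ballI impI)
  fix c d u v
  assume cd: "c \<in> \<A>" "d \<in> \<B>" and uv: "u \<in> chart_dom c" "v \<in> chart_dom d"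
    and eq: "chart_map c u = chart_map d v"
  obtain \<C> where \<C>: "analytic_atlas n X \<C>" "atlas_refines n \<C> \<A>" "atlas_refines n \<C> \<B>"
    using equiv by (auto simp: atlas_equivalent_def)
  have "chart_map d v \<in> chart_image d"
    using uv by (simp add: chart_image_def)
  moreover have "chart_image d \<subseteq> topspace X"
    using \<B> cd(2) analytic_chart_open(2) openin_subset by (fastforce simp: analytic_atlas_def)
  ultimately have "chart_map d v \<in> (\<Union>c\<in>\<C>. chart_image c)"
    using \<C>(1) by (auto simp: analytic_atlas_def)
  then obtain b where b: "b \<in> \<C>" "chart_map d v \<in> chart_image b"
    by blast
  then have b': "analytic_chart n X b"
    using \<C>(1) by (auto simp: analytic_atlas_def)
  obtain w where w: "w \<in> chart_dom b" "chart_map b w = chart_map d v"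
    using b(2) by (rule in_chart_imageE)
  obtain c' d' where c'd': "c' \<in> \<A>" "embeds_analytically n b c'" "d' \<in> \<B>" "embeds_analytically n b d'"
    using \<C>(2,3) b(1) unfolding atlas_refines_def by blast
  obtain u' where u': "u' \<in> chart_dom c'" "chart_map c' u' = chart_map b w" "chart_correspondence n b w c' u'"
    using chart_correspondence_embedding [OF b' c'd'(2) w(1)] .
  obtain v' where v': "v' \<in> chart_dom d'" "chart_map d' v' = chart_map b w" "chart_correspondence n b w d' v'"
    using chart_correspondence_embedding [OF b' c'd'(4) w(1)] .
  have "chart_correspondence n c u c' u'"
    using coh cd(1) c'd'(1) uv(1) u'(1,2) w(2) eq by (intro coherent_chartsD [of n \<A> \<A>]) simp_all
  moreover have "chart_correspondence n d' v' d v"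
    using coherent_charts_atlas [OF \<B>] cd(2) c'd'(3) uv(2) v'(1,2) w(2)
    by (intro coherent_chartsD [of n \<B> \<B>]) simp_all
  ultimately show "chart_correspondence n c u d v"
    using chart_correspondence_sym [OF u'(3)] v'(3) by (meson chart_correspondence_trans)
qed

lemma real_analytic_orbifold_coherent:
  assumes orb: "real_analytic_orbifold n X \<OO>"
  shows "coherent_charts n (\<Union>\<OO>) (\<Union>\<OO>)"
  unfolding coherent_charts_def
proof (intro ballI impI)
  fix c d u v
  assume cd: "c \<in> \<Union>\<OO>" "d \<in> \<Union>\<OO>" and uv: "u \<in> chart_dom c" "v \<in> chart_dom d"
    and eq: "chart_map c u = chart_map d v"
  obtain \<A> where \<A>: "analytic_atlas n X \<A>" "\<OO> = atlas_class n X \<A>"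
    using orb by (auto simp: real_analytic_orbifold_def)
  have coh: "coherent_charts n \<A> \<B>" "analytic_atlas n X \<B>" if "\<B> \<in> \<OO>" for \<B>
    using that coherent_charts_equivalent [OF _ _ coherent_charts_atlas [OF \<A>(1)], of X \<B>]
    by (auto simp: \<A>(2) atlas_class_def)
  obtain \<B> \<C> where \<B>: "\<B> \<in> \<OO>" "c \<in> \<B>" and \<C>: "\<C> \<in> \<OO>" "d \<in> \<C>"
    using cd by blast
  have "chart_map c u \<in> chart_image c"
    using uv by (simp add: chart_image_def)
  moreover have "chart_image c \<subseteq> topspace X"
    using coh(2) [OF \<B>(1)] \<B>(2) analytic_chart_open(2) openin_subset by (fastforce simp: analytic_atlas_def)
  ultimately have "chart_map c u \<in> (\<Union>c\<in>\<A>. chart_image c)"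
    using \<A>(1) by (auto simp: analytic_atlas_def)
  then obtain a w where a: "a \<in> \<A>" "w \<in> chart_dom a" "chart_map a w = chart_map c u"
    by (auto simp: chart_image_def)
  have "chart_correspondence n a w c u" "chart_correspondence n a w d v"
    using coh(1) [OF \<B>(1)] coh(1) [OF \<C>(1)] a \<B>(2) \<C>(2) uv eq by (auto intro: coherent_chartsD)
  then show "chart_correspondence n c u d v"
    using chart_correspondence_trans [OF chart_correspondence_sym] by blast
qed

lemma analytic_chart_in_orbifold:
  assumes "real_analytic_orbifold n X \<OO>" "c \<in> \<Union>\<OO>"
  shows "analytic_chart n X c"
  using assms by (auto simp: real_analytic_orbifold_def atlas_class_def analytic_atlas_def)

lemma coherent_charts_Euclidean: "coherent_charts m {Euclidean_chart m} {Euclidean_chart m}"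
proof -
  have "chart_correspondence m (Euclidean_chart m) u (Euclidean_chart m) u"
    if "u \<in> topspace (Euclidean_space m)" for u
  proof (rule chart_correspondence_analytic [where f = "\<lambda>x. x"])
    show "real_analytic_map m m (topspace (Euclidean_space m)) (\<lambda>x. x)"
      by (simp add: real_analytic_map_def real_analytic_fun_coordinate)
    show "homeomorphic_map (subspace_of m (topspace (Euclidean_space m)))
        (subspace_of m (topspace (Euclidean_space m))) (\<lambda>x. x)"
      using homeomorphic_map_id [of "Euclidean_space m" "Euclidean_space m"]
      by (simp add: id_def subtopology_topspace)
  qed (use that in \<open>auto simp: Euclidean_chart_def\<close>)
  then show ?thesis
    by (auto simp: coherent_charts_def Euclidean_chart_def)
qed

lemma Euclidean_orbifold_chart:
  assumes "d \<in> \<Union>(Euclidean_orbifold m)"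
  shows "analytic_chart m (Euclidean_space m) d"
    and "v \<in> chart_dom d \<Longrightarrow> chart_correspondence m d v (Euclidean_chart m) (chart_map d v)"
proof -
  obtain \<B> where \<B>: "analytic_atlas m (Euclidean_space m) \<B>" "d \<in> \<B>"
      "atlas_equivalent m (Euclidean_space m) {Euclidean_chart m} \<B>"
    using assms by (auto simp: Euclidean_orbifold_def atlas_class_def)
  show d: "analytic_chart m (Euclidean_space m) d"
    using \<B>(1,2) by (auto simp: analytic_atlas_def)
  assume v: "v \<in> chart_dom d"
  have "chart_map d v \<in> topspace (Euclidean_space m)"
    using analytic_chart_open(2) [OF d] openin_subset v by (fastforce simp: chart_image_def)
  then have "chart_correspondence m (Euclidean_chart m) (chart_map d v) d v"
    using coherent_charts_equivalent [OF \<B>(3,1) coherent_charts_Euclidean] \<B>(2) v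
    by (auto intro: coherent_chartsD simp: Euclidean_chart_def)
  then show "chart_correspondence m d v (Euclidean_chart m) (chart_map d v)"
    by (rule chart_correspondence_sym)
qed

section \<open>Maps into Euclidean space seen in a chart\<close>

text \<open>
  Allowing \<open>R\<close> to be larger than the graph of \<open>f\<close> over the neighbourhood \<open>D\<close> of \<open>u\<close> avoids cutting
  down relations when they are composed.
\<close>

definition subanalytic_germ ::
    "nat \<Rightarrow> nat \<Rightarrow> ('g, 'a) orbifold_chart \<Rightarrow> (nat \<Rightarrow> real) \<Rightarrow> ('a \<Rightarrow> nat \<Rightarrow> real) \<Rightarrow> bool" where
  "subanalytic_germ n k c u f \<longleftrightarrow>
     (\<exists>R D. subanalytic_rel n k R \<and> R \<subseteq> {(x, y). x \<in> chart_dom c \<and> y = f (chart_map c x)} \<and>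
        openin (Euclidean_space n) D \<and> u \<in> D \<and> (\<forall>x\<in>D. (x, f (chart_map c x)) \<in> R))"

lemma continuous_map_vec_append:
  assumes f: "continuous_map T (Euclidean_space n) f" and g: "continuous_map T (Euclidean_space m) g"
  shows "continuous_map T (Euclidean_space (n + m)) (\<lambda>x. vec_append n (f x) (g x))"
proof -
  have *: "continuous_map T euclideanreal (\<lambda>x. f x i)" "continuous_map T euclideanreal (\<lambda>x. g x i)" for i
    using continuous_map_compose [OF f continuous_map_coordinate [of n i]]
      continuous_map_compose [OF g continuous_map_coordinate [of m i]] by (simp_all add: comp_def)
  have "continuous_map T (Euclidean_space (n + m))
      (\<lambda>x i. if i < n + m then vec_append n (f x) (g x) i else 0)"
    unfolding continuous_map_componentwise_Euclidean_space
  proof (intro allI impI)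
    fix i
    show "continuous_map T euclideanreal (\<lambda>x. vec_append n (f x) (g x) i)"
      using * by (cases "i < n") (simp_all add: vec_append_def)
  qed
  then show ?thesis
  proof (rule continuous_map_eq)
    fix x assume "x \<in> topspace T"
    then have "vec_append n (f x) (g x) \<in> topspace (Euclidean_space (n + m))"
      using g by (intro vec_append_in) (auto simp: continuous_map_def)
    then show "(\<lambda>i. if i < n + m then vec_append n (f x) (g x) i else 0) = vec_append n (f x) (g x)"
      by (auto simp: in_Euclidean_space)
  qed
qed

text \<open>
  The definition of a subanalytic map only provides a lift into some chart \<open>d\<close> of the orbifold \<open>\<real>\<^sup>m\<close>.
  The correspondence of \<open>d\<close> with the standard chart turns it into a relation with \<open>\<real>\<^sup>m\<close> itself.
\<close>

lemma subanalytic_germ_orbifold_map: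
  fixes f :: "'a \<Rightarrow> nat \<Rightarrow> real" and \<OO> :: "('g, 'a) orbifold_chart set set"
  assumes orb: "real_analytic_orbifold n X \<OO>"
    and f: "subanalytic_orbifold_map n X \<OO> m (Euclidean_space m) (Euclidean_orbifold m) f"
    and x: "x \<in> topspace X"
  obtains c u where "c \<in> \<Union>\<OO>" "u \<in> chart_dom c" "chart_map c u = x" "subanalytic_germ n m c u f"
proof -
  have "\<exists>c\<in>\<Union>\<OO>. \<exists>d\<in>\<Union>(Euclidean_orbifold m). \<exists>\<theta> F. x \<in> chart_image c \<and> f x \<in> chart_image d \<and>
        \<theta> \<in> hom (chart_group c) (chart_group d) \<and>
        subanalytic_map n (chart_dom c) (chart_dom c) m (chart_dom d) (chart_dom d) F \<and>
        (\<forall>g\<in>carrier (chart_group c). \<forall>u\<in>chart_dom c. F (chart_act c g u) = chart_act d (\<theta> g) (F u)) \<and>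
        (\<forall>u\<in>chart_dom c. chart_map d (F u) = f (chart_map c u))"
    using f x unfolding subanalytic_orbifold_map_def by (elim conjE) (erule bspec)
  then obtain c d F where c: "c \<in> \<Union>\<OO>" and d: "d \<in> \<Union>(Euclidean_orbifold m)"
    and x_c: "x \<in> chart_image c"
    and F: "subanalytic_map n (chart_dom c) (chart_dom c) m (chart_dom d) (chart_dom d) F"
    and F_f: "\<And>u. u \<in> chart_dom c \<Longrightarrow> chart_map d (F u) = f (chart_map c u)"
    by (elim bexE exE conjE) simp
  have c': "openin (Euclidean_space n) (chart_dom c)"
    using analytic_chart_in_orbifold [OF orb c] by (rule analytic_chart_open)
  have d': "openin (Euclidean_space m) (chart_dom d)"
    using Euclidean_orbifold_chart(1) [OF d] by (rule analytic_chart_open)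
  note c_E = openin_subset [OF c'] and d_E = openin_subset [OF d']
  obtain u where u: "u \<in> chart_dom c" "chart_map c u = x"
    using x_c by (rule in_chart_imageE)
  have cont: "continuous_map (subspace_of n (chart_dom c)) (subspace_of m (chart_dom d)) F"
    and graph: "subanalytic_in (n + m) (vec_Times n (chart_dom c) (chart_dom d))
        {vec_append n x (F x) | x. x \<in> chart_dom c}"
    using F by (auto simp: subanalytic_map_def)
  have F_d: "F p \<in> chart_dom d" if "p \<in> chart_dom c" for p
    using continuous_map_image_subset_topspace [OF cont] that c_E by auto
  have fx: "f x = chart_map d (F u)"
    using F_f [OF u(1)] u(2) by simp
  have "vec_append n u (F u) \<in> vec_Times n (chart_dom c) (chart_dom d)"
    using u(1) F_d by (auto simp: vec_Times_def)
  then obtain U where U: "openin (Euclidean_space (n + m)) U" "vec_append n u (F u) \<in> U"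
    and bdd: "bounded_subanalytic (n + m) ({vec_append n x (F x) | x. x \<in> chart_dom c} \<inter> U)"
    using subanalytic_in_imp_locally_bounded [OF openin_vec_Times [OF c' d'] graph] by blast
  let ?R = "(\<lambda>p. (p, F p)) ` {p \<in> chart_dom c. vec_append n p (F p) \<in> U}"
  have R: "subanalytic_rel n m ?R"
  proof (rule subanalytic_relI [OF _ bdd])
    show "?R \<subseteq> topspace (Euclidean_space n) \<times> topspace (Euclidean_space m)"
      using c_E d_E F_d by auto
    show "(\<lambda>(x, y). vec_append n x y) ` ?R = {vec_append n x (F x) | x. x \<in> chart_dom c} \<inter> U"
      unfolding image_image by auto
  qed
  have R_lsc: "lower_semicontinuous_at n m ?R u (F u)"
    unfolding lower_semicontinuous_at_def
  proof (intro allI impI)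
    fix N assume N: "openin (Euclidean_space m) N \<and> F u \<in> N"
    have F_E: "continuous_map (subspace_of n (chart_dom c)) (Euclidean_space m) F"
      using cont by (simp add: continuous_map_in_subtopology)
    have "continuous_map (subspace_of n (chart_dom c)) (Euclidean_space n) (\<lambda>p. p)"
      using continuous_map_from_subtopology [OF continuous_map_id] by (simp add: id_def)
    then have "continuous_map (subspace_of n (chart_dom c)) (Euclidean_space (n + m)) (\<lambda>p. vec_append n p (F p))"
      using F_E by (rule continuous_map_vec_append)
    then have "openin (subspace_of n (chart_dom c)) {p \<in> topspace (subspace_of n (chart_dom c)). vec_append n p (F p) \<in> U}"
      using U(1) by (rule openin_continuous_map_preimage)
    moreover have "openin (subspace_of n (chart_dom c)) {p \<in> topspace (subspace_of n (chart_dom c)). F p \<in> N}"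
      using F_E N by (intro openin_continuous_map_preimage) auto
    ultimately have "openin (subspace_of n (chart_dom c))
        ({p \<in> topspace (subspace_of n (chart_dom c)). vec_append n p (F p) \<in> U} \<inter>
         {p \<in> topspace (subspace_of n (chart_dom c)). F p \<in> N})"
      by (rule openin_Int)
    moreover have "{p \<in> topspace (subspace_of n (chart_dom c)). vec_append n p (F p) \<in> U} \<inter>
         {p \<in> topspace (subspace_of n (chart_dom c)). F p \<in> N} =
         {p \<in> chart_dom c. vec_append n p (F p) \<in> U \<and> F p \<in> N}"
      using c_E by auto
    ultimately have "openin (Euclidean_space n) {p \<in> chart_dom c. vec_append n p (F p) \<in> U \<and> F p \<in> N}"
      using openin_trans_full [OF _ c'] by simp
    moreover have "u \<in> {p \<in> chart_dom c. vec_append n p (F p) \<in> U \<and> F p \<in> N}"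
      using u U N by simp
    moreover have "\<forall>p\<in>{p \<in> chart_dom c. vec_append n p (F p) \<in> U \<and> F p \<in> N}. \<exists>y\<in>N. (p, y) \<in> ?R"
      by auto
    ultimately show "\<exists>D. openin (Euclidean_space n) D \<and> u \<in> D \<and> (\<forall>p\<in>D. \<exists>y\<in>N. (p, y) \<in> ?R)"
      by blast
  qed
  have "chart_correspondence m d (F u) (Euclidean_chart m) (chart_map d (F u))"
    using Euclidean_orbifold_chart(2) [OF d F_d [OF u(1)]] .
  then obtain S where S: "subanalytic_rel m m S"
      "S \<subseteq> {(x, y). x \<in> chart_dom d \<and> y \<in> chart_dom (Euclidean_chart m) \<and> chart_map d x = chart_map (Euclidean_chart m) y}"
      "lower_semicontinuous_at m m S (F u) (f x)"
    unfolding chart_correspondence_def fx by blast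
  have comp: "subanalytic_rel n m (?R O S)"
    using R S(1) by (rule subanalytic_rel_comp)
  have sound: "?R O S \<subseteq> {(p, y). p \<in> chart_dom c \<and> y = f (chart_map c p)}"
    using S(2) F_f by (fastforce simp: Euclidean_chart_def)
  have "f x \<in> topspace (Euclidean_space m)"
    using f x by (auto simp: subanalytic_orbifold_map_def)
  then obtain D where D: "openin (Euclidean_space n) D" "u \<in> D"
      "\<And>p. p \<in> D \<Longrightarrow> \<exists>y\<in>topspace (Euclidean_space m). (p, y) \<in> ?R O S"
    using lower_semicontinuous_atD [OF lower_semicontinuous_at_comp [OF R_lsc S(3)] openin_topspace]
    by blast
  have "(p, f (chart_map c p)) \<in> ?R O S" if p: "p \<in> D" for p
  proof -
    obtain y where y: "(p, y) \<in> ?R O S"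
      using D(3) [OF p] by blast
    then have "y = f (chart_map c p)"
      using subsetD [OF sound y] by simp
    then show ?thesis
      using y by simp
  qed
  then have "subanalytic_germ n m c u f"
    unfolding subanalytic_germ_def using comp sound D(1,2) by blast
  then show thesis
    using that c u by blast
qed

lemma subanalytic_germE:
  assumes "subanalytic_germ n k c u f"
  obtains R D where "subanalytic_rel n k R" "R \<subseteq> {(x, y). x \<in> chart_dom c \<and> y = f (chart_map c x)}"
    "openin (Euclidean_space n) D" "u \<in> D" "\<forall>x\<in>D. (x, f (chart_map c x)) \<in> R"
  using assms unfolding subanalytic_germ_def by (elim exE conjE)

lemma subanalytic_germ_transport:
  assumes f: "subanalytic_germ n k d v f" and cd: "chart_correspondence n c u d v"
  shows "subanalytic_germ n k c u f"
proof -
  obtain R D where R: "subanalytic_rel n k R" "R \<subseteq> {(x, y). x \<in> chart_dom d \<and> y = f (chart_map d x)}"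
    and D: "openin (Euclidean_space n) D" "v \<in> D" "\<forall>x\<in>D. (x, f (chart_map d x)) \<in> R"
    using f by (rule subanalytic_germE)
  obtain S where S: "subanalytic_rel n n S"
    "S \<subseteq> {(x, y). x \<in> chart_dom c \<and> y \<in> chart_dom d \<and> chart_map c x = chart_map d y}"
    "lower_semicontinuous_at n n S u v"
    using cd unfolding chart_correspondence_def by blast
  obtain D' where D': "openin (Euclidean_space n) D'" "u \<in> D'" "\<And>x. x \<in> D' \<Longrightarrow> \<exists>y\<in>D. (x, y) \<in> S"
    using lower_semicontinuous_atD [OF S(3) D(1,2)] by blast
  have "(x, f (chart_map c x)) \<in> S O R" if x: "x \<in> D'" for x
  proof -
    obtain y where y: "y \<in> D" "(x, y) \<in> S"
      using D'(3) [OF x] by blast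
    then have "chart_map c x = chart_map d y"
      using S(2) by auto
    then show ?thesis
      using y D(3) by auto
  qed
  moreover have "S O R \<subseteq> {(x, y). x \<in> chart_dom c \<and> y = f (chart_map c x)}"
    using S(2) R(2) by fastforce
  ultimately show ?thesis
    unfolding subanalytic_germ_def using subanalytic_rel_comp [OF S(1) R(1)] D'(1,2) by blast
qed

text \<open>
  The saturation of \<open>D\<close> is the union of its translates under the chart group.
\<close>

lemma chart_map_open:
  assumes c: "analytic_chart n X c" and D: "openin (Euclidean_space n) D" "D \<subseteq> chart_dom c"
  shows "openin X (chart_map c ` D)"
proof -
  let ?T = "subspace_of n (chart_dom c)" and ?G = "carrier (chart_group c)"
  have U: "openin (Euclidean_space n) (chart_dom c)" and I: "openin X (chart_image c)"
    using c by (auto dest: analytic_chart_open)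
  have top: "topspace ?T = chart_dom c"
    using openin_subset [OF U] by auto
  have q: "quotient_map ?T (subtopology X (chart_image c)) (chart_map c)"
    and homeo: "\<And>g. g \<in> ?G \<Longrightarrow> homeomorphic_map ?T ?T (chart_act c g)"
    and orbit: "\<And>x y. x \<in> chart_dom c \<Longrightarrow> y \<in> chart_dom c \<Longrightarrow>
        chart_map c x = chart_map c y \<longleftrightarrow> y \<in> orbit (chart_group c) (chart_act c) x"
    using c by (auto simp: analytic_chart_def orbifold_chart_def)
  have DT: "openin ?T D"
    using D by (simp add: openin_open_subtopology U)
  have "{x \<in> chart_dom c. chart_map c x \<in> chart_map c ` D} = (\<Union>g\<in>?G. chart_act c g ` D)"
  proof (intro equalityI subsetI)
    fix x assume "x \<in> {x \<in> chart_dom c. chart_map c x \<in> chart_map c ` D}"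
    then obtain y where y: "y \<in> D" "chart_map c y = chart_map c x" "x \<in> chart_dom c"
      by auto
    then have "x \<in> orbit (chart_group c) (chart_act c) y"
      using orbit D(2) by blast
    then show "x \<in> (\<Union>g\<in>?G. chart_act c g ` D)"
      using y(1) by (auto simp: orbit_def)
  next
    fix x assume "x \<in> (\<Union>g\<in>?G. chart_act c g ` D)"
    then obtain g y where g: "g \<in> ?G" "y \<in> D" "x = chart_act c g y"
      by blast
    then have "x \<in> chart_dom c"
      using homeomorphic_imp_surjective_map [OF homeo [OF g(1)]] D(2) top by blast
    moreover have "chart_map c y = chart_map c x"
      using orbit [of y x] g D(2) \<open>x \<in> chart_dom c\<close> by (auto simp: orbit_def)
    ultimately show "x \<in> {x \<in> chart_dom c. chart_map c x \<in> chart_map c ` D}"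
      using g(2) by (metis (mono_tags, lifting) image_eqI mem_Collect_eq)
  qed
  moreover have "openin ?T (\<Union>g\<in>?G. chart_act c g ` D)"
    using homeomorphic_imp_open_map [OF homeo] DT by (intro openin_Union) (auto simp: open_map_def)
  ultimately have open_pre: "openin ?T {x \<in> topspace ?T. chart_map c x \<in> chart_map c ` D}"
    by (simp only: top)
  have "chart_map c ` D \<subseteq> topspace (subtopology X (chart_image c))"
    using D(2) openin_subset [OF I] by (auto simp: chart_image_def)
  with q open_pre have "openin (subtopology X (chart_image c)) (chart_map c ` D)"
    unfolding quotient_map_def by blast
  then show ?thesis
    using I openin_trans_full by blast
qed

text \<open>
  The set of the pairs \<open>(f x, g x)\<close> is \<open>R\<inverse> O R'\<close> for the relations representing \<open>f\<close> and \<open>g\<close>. It is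
  taken over all \<open>x\<close> for which both relations are defined, a set \<open>W\<close> known only to contain an open
  neighbourhood \<open>V\<close>.
\<close>

lemma subanalytic_germ_pair:
  assumes c: "analytic_chart n X c"
    and f: "subanalytic_germ n k c u f" and g: "subanalytic_germ n m c u g"
  obtains V W where "openin X V" "chart_map c u \<in> V" "V \<subseteq> W" "W \<subseteq> topspace X"
    "subanalytic_rel k m ((\<lambda>x. (f x, g x)) ` W)"
proof -
  obtain R D where R: "subanalytic_rel n k R" "R \<subseteq> {(x, y). x \<in> chart_dom c \<and> y = f (chart_map c x)}"
    and D: "openin (Euclidean_space n) D" "u \<in> D" "\<forall>x\<in>D. (x, f (chart_map c x)) \<in> R"
    using f by (rule subanalytic_germE)
  obtain R' D' where R': "subanalytic_rel n m R'" "R' \<subseteq> {(x, y). x \<in> chart_dom c \<and> y = g (chart_map c x)}"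
    and D': "openin (Euclidean_space n) D'" "u \<in> D'" "\<forall>x\<in>D'. (x, g (chart_map c x)) \<in> R'"
    using g by (rule subanalytic_germE)
  let ?P = "Domain R \<inter> Domain R'"
  have P: "?P \<subseteq> chart_dom c"
    using R(2) by blast
  have "D \<inter> D' \<subseteq> ?P"
    using D(3) D'(3) by blast
  then have "openin X (chart_map c ` (D \<inter> D'))" "chart_map c ` (D \<inter> D') \<subseteq> chart_map c ` ?P"
    using c D(1) D'(1) P by (auto intro!: chart_map_open [of n] openin_Int)
  moreover have "R\<inverse> O R' = (\<lambda>x. (f x, g x)) ` chart_map c ` ?P"
  proof (intro equalityI subsetI)
    fix t assume "t \<in> R\<inverse> O R'"
    then obtain x where x: "(x, fst t) \<in> R" "(x, snd t) \<in> R'"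
      by auto
    then have "t = (f (chart_map c x), g (chart_map c x))"
      using R(2) R'(2) by (auto simp: prod_eq_iff)
    then show "t \<in> (\<lambda>x. (f x, g x)) ` chart_map c ` ?P"
      using x by blast
  next
    fix t assume "t \<in> (\<lambda>x. (f x, g x)) ` chart_map c ` ?P"
    then obtain x y z where x: "(x, y) \<in> R" "(x, z) \<in> R'" "t = (f (chart_map c x), g (chart_map c x))"
      by blast
    then have "y = f (chart_map c x)" "z = g (chart_map c x)"
      using R(2) R'(2) by auto
    then show "t \<in> R\<inverse> O R'"
      using x by blast
  qed
  then have "subanalytic_rel k m ((\<lambda>x. (f x, g x)) ` chart_map c ` ?P)"
    using subanalytic_rel_comp [OF subanalytic_rel_converse [OF R(1)] R'(1)] by simp
  moreover have "chart_map c ` ?P \<subseteq> topspace X"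
    using P openin_subset [OF analytic_chart_open(2) [OF c]] by (auto simp: chart_image_def)
  ultimately show thesis
    using that [of "chart_map c ` (D \<inter> D')" "chart_map c ` ?P"] D(2) D'(2) by blast
qed

section \<open>Changing the linear embedding of a complex\<close>

lemma closed_linear_embedding_in:
  assumes "closed_linear_embedding K m e" "b \<in> complex_space K"
  shows "e b \<in> topspace (Euclidean_space m)"
proof -
  have "continuous_map (complex_topology K) (Euclidean_space m) e"
    using assms(1) by (auto simp: closed_linear_embedding_def embedding_map_def
        continuous_map_in_subtopology dest: homeomorphic_imp_continuous_map)
  then show ?thesis
    using assms(2) by (auto simp: continuous_map_def topspace_complex_topology)
qed

lemma closed_linear_embedding_inj:
  assumes "closed_linear_embedding K m e"
  shows "inj_on e (complex_space K)"
  using assms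
  by (simp add: closed_linear_embedding_def embedding_map_def homeomorphic_map_def topspace_complex_topology)

lemma openin_open_star: "openin (complex_topology K) {b \<in> complex_space K. 0 < b v}"
proof -
  have "openin (subtopology (powertop_real UNIV) (closed_simplex s))
     ({b \<in> complex_space K. 0 < b v} \<inter> closed_simplex s)" if "s \<in> K" for s
  proof -
    have "openin (powertop_real UNIV) {b \<in> topspace (powertop_real UNIV). b v \<in> {0<..}}"
      by (intro openin_continuous_map_preimage [OF continuous_map_product_projection]) auto
    moreover have "{b \<in> complex_space K. 0 < b v} \<inter> closed_simplex s =
        {b \<in> topspace (powertop_real UNIV). b v \<in> {0<..}} \<inter> closed_simplex s"
      using that by (auto simp: complex_space_def)
    ultimately show ?thesis
      by (simp only: openin_subtopology_Int)
  qed
  then show ?thesis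
    by (auto simp: openin_complex_topology)
qed

text \<open>
  Local finiteness leaves finitely many simplices around the vertex \<open>v\<close>.
\<close>

lemma subanalytic_rel_change_embedding:
  assumes K: "simplicial_complex K" and lf: "locally_finite_complex K"
    and e: "closed_linear_embedding K m e" and d: "closed_linear_embedding K k d"
  shows "subanalytic_rel m k ((\<lambda>b. (e b, d b)) ` (\<Union>s\<in>{s \<in> K. v \<in> s}. closed_simplex s))"
proof -
  have "subanalytic_rel m k ((\<lambda>b. (e b, d b)) ` closed_simplex s)" if s: "s \<in> K" for s
  proof -
    have s': "finite s" "\<And>t. t \<subseteq> s \<Longrightarrow> t \<noteq> {} \<Longrightarrow> t \<in> K"
      using bspec [OF K [unfolded simplicial_complex_def] s] by simp_all
    have v: "vertex_point v \<in> complex_space K" if "v \<in> s" for v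
    proof -
      have "{v} \<in> K"
        using s'(2) [of "{v}"] that by simp
      moreover have "vertex_point v \<in> closed_simplex {v}"
        by (simp add: vertex_point_def closed_simplex_def)
      ultimately show ?thesis
        unfolding complex_space_def by blast
    qed
    have "subanalytic_rel m k ((\<lambda>b. (\<lambda>i. \<Sum>v\<in>s. b v * e (vertex_point v) i,
        \<lambda>i. \<Sum>v\<in>s. b v * d (vertex_point v) i)) ` closed_simplex s)"
      using s'(1) by (rule subanalytic_rel_simplex)
        (rule closed_linear_embedding_in [OF e v] closed_linear_embedding_in [OF d v], assumption)+
    moreover have eq: "(e b, d b) = (\<lambda>i. \<Sum>v\<in>s. b v * e (vertex_point v) i,
        \<lambda>i. \<Sum>v\<in>s. b v * d (vertex_point v) i)" if "b \<in> closed_simplex s" for b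
    proof -
      have "e b = (\<lambda>i. \<Sum>v\<in>s. b v * e (vertex_point v) i)" "d b = (\<lambda>i. \<Sum>v\<in>s. b v * d (vertex_point v) i)"
        using e d s that unfolding closed_linear_embedding_def by blast+
      then show ?thesis
        by (rule arg_cong2 [where f = Pair])
    qed
    then have "(\<lambda>b. (e b, d b)) ` closed_simplex s = (\<lambda>b. (\<lambda>i. \<Sum>v\<in>s. b v * e (vertex_point v) i,
        \<lambda>i. \<Sum>v\<in>s. b v * d (vertex_point v) i)) ` closed_simplex s"
      by (rule image_cong [OF refl])
    ultimately show ?thesis
      by (simp only:)
  qed
  then show ?thesis
    unfolding image_UN using lf by (intro subanalytic_rel_UN) (auto simp: locally_finite_complex_def)
qed

lemma complex_space_positive_vertex:
  assumes "b \<in> complex_space K"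
  obtains v where "0 < b v"
proof -
  obtain s where s: "b \<in> closed_simplex s"
    using assms by (auto simp: complex_space_def)
  have "\<exists>v\<in>s. b v \<noteq> 0"
    using s by (auto simp: closed_simplex_def intro: ccontr)
  then show thesis
    using s that by (auto simp: closed_simplex_def order_less_le)
qed

text \<open>
  The point over \<open>u\<close> has a positive barycentric coordinate at some vertex \<open>v\<close>. The points with this property form
  an open set contained in the finitely many simplices around \<open>v\<close>, on which the change of embedding is a
  bounded subanalytic relation.
\<close>

lemma subanalytic_germ_change_embedding:
  assumes c: "analytic_chart n X c" and u: "u \<in> chart_dom c"
    and K: "simplicial_complex K" "locally_finite_complex K"
    and e: "closed_linear_embedding K m e" and d: "closed_linear_embedding K k d"
    and g: "continuous_map X (complex_topology K) g"
    and germ: "subanalytic_germ n m c u (e \<circ> g)"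
  shows "subanalytic_germ n k c u (d \<circ> g)"
proof -
  let ?T = "subspace_of n (chart_dom c)"
  have U: "openin (Euclidean_space n) (chart_dom c)" and I: "openin X (chart_image c)"
    using c by (auto dest: analytic_chart_open)
  have in_X: "chart_map c p \<in> topspace X" if "p \<in> chart_dom c" for p
    using openin_subset [OF I] that by (auto simp: chart_image_def)
  have in_K: "g (chart_map c p) \<in> complex_space K" if "p \<in> chart_dom c" for p
    using continuous_map_image_subset_topspace [OF g] in_X [OF that]
    by (auto simp: topspace_complex_topology)
  obtain R D where R: "subanalytic_rel n m R" "R \<subseteq> {(x, y). x \<in> chart_dom c \<and> y = (e \<circ> g) (chart_map c x)}"
    and D: "openin (Euclidean_space n) D" "u \<in> D" "\<forall>x\<in>D. (x, (e \<circ> g) (chart_map c x)) \<in> R"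
    using germ by (rule subanalytic_germE)
  obtain v where v: "0 < g (chart_map c u) v"
    using complex_space_positive_vertex [OF in_K [OF u]] .
  let ?S = "\<Union>s\<in>{s \<in> K. v \<in> s}. closed_simplex s"
  let ?H = "(\<lambda>b. (e b, d b)) ` ?S"
  have S: "?S \<subseteq> complex_space K"
    by (auto simp: complex_space_def)
  have star: "b \<in> ?S" if b: "b \<in> complex_space K" "0 < b v" for b
  proof -
    obtain s where s: "s \<in> K" "b \<in> closed_simplex s"
      using b(1) unfolding complex_space_def by blast
    then have "v \<in> s"
      using b(2) unfolding closed_simplex_def by force
    with s show ?thesis
      by blast
  qed
  have "continuous_map ?T (subtopology X (chart_image c)) (chart_map c)"
    using c by (auto simp: analytic_chart_def orbifold_chart_def intro: quotient_imp_continuous_map)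
  then have "continuous_map ?T X (chart_map c)"
    by (simp add: continuous_map_in_subtopology)
  then have "continuous_map ?T (complex_topology K) (g \<circ> chart_map c)"
    using g by (rule continuous_map_compose)
  then have "openin ?T {p \<in> topspace ?T. (g \<circ> chart_map c) p \<in> {b \<in> complex_space K. 0 < b v}}"
    using openin_open_star by (rule openin_continuous_map_preimage)
  moreover have "{p \<in> topspace ?T. (g \<circ> chart_map c) p \<in> {b \<in> complex_space K. 0 < b v}} =
      {p \<in> chart_dom c. 0 < g (chart_map c p) v}"
    using openin_subset [OF U] in_K by auto
  ultimately have O': "openin (Euclidean_space n) {p \<in> chart_dom c. 0 < g (chart_map c p) v}"
    using openin_trans_full [OF _ U] by simp
  have "R O ?H \<subseteq> {(x, y). x \<in> chart_dom c \<and> y = (d \<circ> g) (chart_map c x)}"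
  proof (rule subrelI)
    fix x z assume "(x, z) \<in> R O ?H"
    then obtain b where b: "(x, e b) \<in> R" "b \<in> ?S" "z = d b"
      by auto
    then have x: "x \<in> chart_dom c" "e b = e (g (chart_map c x))"
      using R(2) by auto
    then have "b = g (chart_map c x)"
      using inj_onD [OF closed_linear_embedding_inj [OF e]] b(2) S in_K by blast
    then show "(x, z) \<in> {(x, y). x \<in> chart_dom c \<and> y = (d \<circ> g) (chart_map c x)}"
      using x b(3) by simp
  qed
  moreover have "(x, (d \<circ> g) (chart_map c x)) \<in> R O ?H"
    if "x \<in> D \<inter> {p \<in> chart_dom c. 0 < g (chart_map c p) v}" for x
  proof -
    have "g (chart_map c x) \<in> ?S"
      using that in_K star by auto
    then show ?thesis
      using D(3) that by (intro relcompI [of _ "e (g (chart_map c x))"]) auto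
  qed
  moreover have "subanalytic_rel n k (R O ?H)"
    using R(1) subanalytic_rel_change_embedding [OF K e d] by (rule subanalytic_rel_comp)
  moreover have "openin (Euclidean_space n) (D \<inter> {p \<in> chart_dom c. 0 < g (chart_map c p) v})"
    using D(1) O' by (rule openin_Int)
  ultimately show ?thesis
    unfolding subanalytic_germ_def using D(2) u v by (intro exI conjI) (assumption | auto)+
qed

section \<open>The transition map\<close>

lemma homeomorphic_map_inv_into:
  assumes "homeomorphic_map X Y f"
  shows "continuous_map Y X (inv_into (topspace X) f)"
proof -
  obtain g where g: "homeomorphic_maps X Y f g"
    using assms homeomorphic_map_maps by blast
  have inj: "inj_on f (topspace X)"
    using assms homeomorphic_imp_injective_map by blast
  show ?thesis
  proof (rule continuous_map_eq)
    show "continuous_map Y X g"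
      using g by (simp add: homeomorphic_maps_def)
    fix y assume y: "y \<in> topspace Y"
    then have "g y \<in> topspace X" "f (g y) = y"
      using g by (auto simp: homeomorphic_maps_def continuous_map_def)
    then show "g y = inv_into (topspace X) f y"
      using inv_into_f_f [OF inj] by force
  qed
qed

lemma subanalytic_complex_map_cong:
  assumes "\<And>b. b \<in> complex_space K \<Longrightarrow> f b = g b"
  shows "subanalytic_complex_map K L f \<longleftrightarrow> subanalytic_complex_map K L g"
proof -
  have eq: "(d \<circ> f \<circ> inv_into (complex_space K) e) x = (d \<circ> g \<circ> inv_into (complex_space K) e) x"
    if "x \<in> e ` complex_space K" for d :: "('b \<Rightarrow> real) \<Rightarrow> nat \<Rightarrow> real" and e x
    using assms [OF inv_into_into [OF that]] by simp
  have graph: "{vec_append m x ((d \<circ> f \<circ> inv_into (complex_space K) e) x) | x. x \<in> e ` complex_space K} =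
      {vec_append m x ((d \<circ> g \<circ> inv_into (complex_space K) e) x) | x. x \<in> e ` complex_space K}"
    for m and d :: "('b \<Rightarrow> real) \<Rightarrow> nat \<Rightarrow> real" and e
    by (intro Collect_cong ex_cong1) (metis eq)
  have cont: "continuous_map (subspace_of m (e ` complex_space K)) T (d \<circ> f \<circ> inv_into (complex_space K) e)
      \<longleftrightarrow> continuous_map (subspace_of m (e ` complex_space K)) T (d \<circ> g \<circ> inv_into (complex_space K) e)"
    for m T and d :: "('b \<Rightarrow> real) \<Rightarrow> nat \<Rightarrow> real" and e
  proof -
    have "x \<in> e ` complex_space K" if "x \<in> topspace (subspace_of m (e ` complex_space K))" for x
      using that by simp
    then show ?thesis
      using eq [of _ e d] by (metis (no_types, lifting) continuous_map_eq)
  qed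
  have "f ` complex_space K = g ` complex_space K"
    using assms by (rule image_cong [OF refl])
  then show ?thesis
    unfolding subanalytic_complex_map_def subanalytic_map_def graph cont by simp
qed

context
  fixes n :: nat and X :: "'a topology" and \<OO> :: "('g, 'a) orbifold_chart set set"
  assumes orbifold: "real_analytic_orbifold n X \<OO>"
begin

lemma triangulation_germ:
  fixes K :: "'v set set"
  assumes \<tau>: "subanalytic_triangulation n X \<OO> K \<tau>" and d: "closed_linear_embedding K k d"
    and x: "x \<in> topspace X"
  obtains c u where "c \<in> \<Union>\<OO>" "u \<in> chart_dom c" "chart_map c u = x"
    "subanalytic_germ n k c u (d \<circ> inv_into (complex_space K) \<tau>)"
proof -
  let ?g = "inv_into (complex_space K) \<tau>"
  have K: "simplicial_complex K" "locally_finite_complex K"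
    and homeo: "homeomorphic_map (complex_topology K) X \<tau>"
    and into: "subanalytic_into_complex n X \<OO> K ?g"
    using \<tau> by (auto simp: subanalytic_triangulation_def)
  obtain m e where e: "closed_linear_embedding K m e"
    and f: "subanalytic_orbifold_map n X \<OO> m (Euclidean_space m) (Euclidean_orbifold m) (e \<circ> ?g)"
    using into by (auto simp: subanalytic_into_complex_def)
  obtain c u where c: "c \<in> \<Union>\<OO>" "u \<in> chart_dom c" "chart_map c u = x"
    and germ: "subanalytic_germ n m c u (e \<circ> ?g)"
    using subanalytic_germ_orbifold_map [OF orbifold f x] .
  have "continuous_map X (complex_topology K) ?g"
    using homeomorphic_map_inv_into [OF homeo] by (simp add: topspace_complex_topology)
  from subanalytic_germ_change_embedding
      [OF analytic_chart_in_orbifold [OF orbifold c(1)] c(2) K e d this germ]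
  have "subanalytic_germ n k c u (d \<circ> ?g)" .
  then show thesis
    using that c by blast
qed

text \<open>
  The two maps are subanalytic in different charts; the correspondence of these charts over \<open>x\<close> brings both into
  the chart \<open>c\<close>.
\<close>

lemma transition_locally_subanalytic:
  fixes K :: "'v set set" and L :: "'w set set"
  assumes \<sigma>: "subanalytic_triangulation n X \<OO> K \<sigma>" and e: "closed_linear_embedding K m e"
    and \<tau>: "subanalytic_triangulation n X \<OO> L \<tau>" and d: "closed_linear_embedding L k d"
    and x: "x \<in> topspace X"
  obtains V W where "openin X V" "x \<in> V" "V \<subseteq> W" "W \<subseteq> topspace X"
    "subanalytic_rel m k
       ((\<lambda>x. (e (inv_into (complex_space K) \<sigma> x), d (inv_into (complex_space L) \<tau> x))) ` W)"
proof -
  obtain c u where c: "c \<in> \<Union>\<OO>" "u \<in> chart_dom c" "chart_map c u = x"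
    and germ: "subanalytic_germ n m c u (e \<circ> inv_into (complex_space K) \<sigma>)"
    using triangulation_germ [OF \<sigma> e x] .
  obtain c' u' where c': "c' \<in> \<Union>\<OO>" "u' \<in> chart_dom c'" "chart_map c' u' = x"
    and germ': "subanalytic_germ n k c' u' (d \<circ> inv_into (complex_space L) \<tau>)"
    using triangulation_germ [OF \<tau> d x] .
  have "chart_correspondence n c u c' u'"
    using c(3) c'(3)
    by (intro coherent_chartsD [OF real_analytic_orbifold_coherent [OF orbifold] c(1) c'(1) c(2) c'(2)])
      simp
  with germ' have germ'': "subanalytic_germ n k c u (d \<circ> inv_into (complex_space L) \<tau>)"
    by (rule subanalytic_germ_transport)
  from subanalytic_germ_pair [OF analytic_chart_in_orbifold [OF orbifold c(1)] germ germ'']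
  obtain V W where "openin X V" "chart_map c u \<in> V" "V \<subseteq> W" "W \<subseteq> topspace X"
      "subanalytic_rel m k ((\<lambda>x. ((e \<circ> inv_into (complex_space K) \<sigma>) x,
          (d \<circ> inv_into (complex_space L) \<tau>) x)) ` W)" .
  then show thesis
    using that [of V W] c(3) by (simp only: comp_apply)
qed

lemma transition_subanalytic:
  fixes K :: "'v set set" and L :: "'w set set"
  assumes \<sigma>: "subanalytic_triangulation n X \<OO> K \<sigma>" and \<tau>: "subanalytic_triangulation n X \<OO> L \<tau>"
  shows "subanalytic_complex_map K L (inv_into (complex_space L) \<tau> \<circ> \<sigma>)"
proof -
  let ?g = "inv_into (complex_space K) \<sigma>" and ?h = "inv_into (complex_space L) \<tau>"
  have homeo: "homeomorphic_map (complex_topology K) X \<sigma>" "homeomorphic_map (complex_topology L) X \<tau>"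
    using \<sigma> \<tau> by (auto simp: subanalytic_triangulation_def)
  have cont_\<sigma>: "continuous_map (complex_topology K) X \<sigma>"
    and cont_h: "continuous_map X (complex_topology L) ?h"
    using homeomorphic_imp_continuous_map [OF homeo(1)] homeomorphic_map_inv_into [OF homeo(2)]
    by (simp_all add: topspace_complex_topology)
  have \<sigma>_image: "\<sigma> ` complex_space K = topspace X"
    using homeomorphic_imp_surjective_map [OF homeo(1)] by (simp add: topspace_complex_topology)
  have \<sigma>_inj: "inj_on \<sigma> (complex_space K)"
    using homeomorphic_imp_injective_map [OF homeo(1)] by (simp add: topspace_complex_topology)
  have h_in: "?h x \<in> complex_space L" if "x \<in> topspace X" for x
    using continuous_map_image_subset_topspace [OF cont_h] that by (auto simp: topspace_complex_topology)
  have g_\<sigma>: "?g (\<sigma> b) = b" if "b \<in> complex_space K" for b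
    using \<sigma>_inj that by (rule inv_into_f_f)
  have main: "subanalytic_map m (topspace (Euclidean_space m)) (e ` complex_space K)
        k (topspace (Euclidean_space k)) (d ` complex_space L)
        (d \<circ> (?h \<circ> \<sigma>) \<circ> inv_into (complex_space K) e)"
    if e: "closed_linear_embedding K m e" and d: "closed_linear_embedding L k d" for m e k d
  proof -
    let ?i = "inv_into (complex_space K) e"
    let ?F = "d \<circ> (?h \<circ> \<sigma>) \<circ> ?i"
    have e_homeo: "homeomorphic_map (complex_topology K) (subspace_of m (e ` complex_space K)) e"
      and closed: "closedin (Euclidean_space m) (e ` complex_space K)"
      using e by (auto simp: closed_linear_embedding_def embedding_map_def topspace_complex_topology)
    have d_cont: "continuous_map (complex_topology L) (subspace_of k (d ` complex_space L)) d"
      using d by (auto simp: closed_linear_embedding_def embedding_map_def topspace_complex_topology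
          dest: homeomorphic_imp_continuous_map)
    have i_cont: "continuous_map (subspace_of m (e ` complex_space K)) (complex_topology K) ?i"
      using homeomorphic_map_inv_into [OF e_homeo] by (simp add: topspace_complex_topology)
    have i_e: "?i (e b) = b" if "b \<in> complex_space K" for b
      using closed_linear_embedding_inj [OF e] that by (rule inv_into_f_f)
    have \<sigma>_i: "continuous_map (subspace_of m (e ` complex_space K)) X (\<sigma> \<circ> ?i)"
      using i_cont cont_\<sigma> by (rule continuous_map_compose)
    have "continuous_map (subspace_of m (e ` complex_space K)) (subspace_of k (d ` complex_space L))
        (d \<circ> (?h \<circ> (\<sigma> \<circ> ?i)))"
      by (rule continuous_map_compose [OF continuous_map_compose [OF \<sigma>_i cont_h] d_cont])
    then have cont: "continuous_map (subspace_of m (e ` complex_space K)) (subspace_of k (d ` complex_space L)) ?F"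
      by (simp add: comp_assoc)
    let ?\<Gamma> = "{vec_append m y (?F y) | y. y \<in> e ` complex_space K}"
    let ?r = "\<lambda>x. (e (?g x), d (?h x))"
    let ?v = "\<lambda>(y, z). vec_append m y z"
    have \<Gamma>: "?\<Gamma> = ?v ` ?r ` topspace X"
    proof -
      have "?\<Gamma> = (\<lambda>y. vec_append m y (?F y)) ` e ` complex_space K"
        by blast
      also have "\<dots> = (\<lambda>b. vec_append m (e b) (d (?h (\<sigma> b)))) ` complex_space K"
        unfolding image_image by (rule image_cong) (simp_all add: i_e)
      also have "\<dots> = (\<lambda>b. ?v (?r (\<sigma> b))) ` complex_space K"
        by (rule image_cong) (simp_all add: g_\<sigma>)
      also have "\<dots> = ?v ` ?r ` \<sigma> ` complex_space K"
        by (simp only: image_image)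
      finally show ?thesis
        by (simp only: \<sigma>_image)
    qed
    have r_in: "e (?g x) \<in> topspace (Euclidean_space m)" "d (?h x) \<in> topspace (Euclidean_space k)"
      if x: "x \<in> topspace X" for x
    proof -
      have "?g x \<in> complex_space K"
        using x \<sigma>_image by (intro inv_into_into) simp
      then show "e (?g x) \<in> topspace (Euclidean_space m)"
        using e closed_linear_embedding_in by blast
      show "d (?h x) \<in> topspace (Euclidean_space k)"
        using d h_in [OF x] closed_linear_embedding_in by blast
    qed
    have "subanalytic_in (m + k) (topspace (Euclidean_space (m + k))) ?\<Gamma>"
    proof (rule locally_bounded_imp_subanalytic_in)
      show "?\<Gamma> \<subseteq> topspace (Euclidean_space (m + k))"
        unfolding \<Gamma> using r_in by (auto intro: vec_append_in)
      fix w assume w: "w \<in> topspace (Euclidean_space (m + k))"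
      \<comment> \<open>The points of \<open>X\<close> that can contribute to the graph inside \<open>?U\<close> lie in the compact set \<open>S\<close>.\<close>
      let ?U = "open_box (m + k) w 1" and ?C = "closed_box m (vec_take m w) 1"
      define S where "S = (\<sigma> \<circ> ?i) ` (e ` complex_space K \<inter> ?C)"
      have "compactin (Euclidean_space m) (e ` complex_space K \<inter> ?C)"
        using closed compactin_closed_box by (rule closed_Int_compactin)
      then have "compactin (subspace_of m (e ` complex_space K)) (e ` complex_space K \<inter> ?C)"
        by (simp add: compactin_subtopology)
      then have S: "compactin X S"
        unfolding S_def using \<sigma>_i by (rule image_compactin)
      define good where "good V W \<longleftrightarrow> openin X V \<and> V \<subseteq> W \<and> W \<subseteq> topspace X \<and> subanalytic_rel m k (?r ` W)"
        for V W
      have "\<exists>V W. x \<in> V \<and> good V W" if x: "x \<in> topspace X" for x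
        by (rule transition_locally_subanalytic [OF \<sigma> e \<tau> d x])
          (unfold good_def, intro exI conjI, assumption+)
      then have "\<forall>x\<in>topspace X. \<exists>P. x \<in> fst P \<and> good (fst P) (snd P)"
        by simp
      then obtain P where P: "\<forall>x\<in>topspace X. x \<in> fst (P x) \<and> good (fst (P x)) (snd (P x))"
        by (rule bchoice [THEN exE])
      define V W where "V = fst \<circ> P" and "W = snd \<circ> P"
      have VW: "x \<in> V x" "good (V x) (W x)" if "x \<in> topspace X" for x
        using P that by (simp_all add: V_def W_def)
      have S_X: "S \<subseteq> topspace X"
        using S by (rule compactin_subset_topspace)
      have "\<exists>\<V>. finite \<V> \<and> \<V> \<subseteq> V ` S \<and> S \<subseteq> \<Union>\<V>"
      proof (rule compactinD [OF S])
        show "openin X U" if "U \<in> V ` S" for U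
          using that VW(2) S_X by (auto simp: good_def)
        show "S \<subseteq> \<Union>(V ` S)"
          using VW(1) S_X by blast
      qed
      then obtain \<V> where "finite \<V>" "\<V> \<subseteq> V ` S" and cover: "S \<subseteq> \<Union>\<V>"
        by blast
      then obtain I where I: "I \<subseteq> S" "finite I" "\<V> = V ` I"
        by (meson finite_subset_image)
      have I_good: "good (V x) (W x)" if "x \<in> I" for x
        using VW(2) I(1) S_X that by blast
      have "?\<Gamma> \<inter> ?U = (\<Union>x\<in>I. ?v ` ?r ` W x) \<inter> ?U"
      proof (intro equalityI subsetI)
        fix z assume z: "z \<in> ?\<Gamma> \<inter> ?U"
        then have "z \<in> ?v ` ?r ` \<sigma> ` complex_space K"
          unfolding \<Gamma> \<sigma>_image by (rule IntD1)
        then obtain b where b: "b \<in> complex_space K" "z = ?v (?r (\<sigma> b))"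
          unfolding image_image by (rule imageE)
        then have z_b: "z = vec_append m (e b) (d (?h (\<sigma> b)))"
          by (simp add: g_\<sigma>)
        then have "vec_take m z = e b"
          using closed_linear_embedding_in [OF e b(1)] by (simp add: vec_take_append)
        then have "e b i = z i" if "i < m" for i
          using that by (metis vec_take_def)
        moreover have "\<bar>z i - w i\<bar> < 1" if "i < m" for i
          using z that by (simp add: open_box_def)
        ultimately have "e b \<in> ?C"
          using closed_linear_embedding_in [OF e b(1)]
          by (auto simp: closed_box_def vec_take_def intro: less_imp_le)
        then have "(\<sigma> \<circ> ?i) (e b) \<in> S"
          unfolding S_def using b(1) by blast
        then have "\<sigma> b \<in> S"
          by (simp add: i_e b(1))
        then obtain x where x: "x \<in> I" "\<sigma> b \<in> V x"
          using cover I(3) by blast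
        then have "\<sigma> b \<in> W x"
          using I_good [OF x(1)] unfolding good_def by blast
        then show "z \<in> (\<Union>x\<in>I. ?v ` ?r ` W x) \<inter> ?U"
          using z b(2) x(1) by blast
      next
        fix z assume z: "z \<in> (\<Union>x\<in>I. ?v ` ?r ` W x) \<inter> ?U"
        have "W x \<subseteq> topspace X" if "x \<in> I" for x
          using I_good [OF that] by (simp add: good_def)
        then show "z \<in> ?\<Gamma> \<inter> ?U"
          unfolding \<Gamma> using z by blast
      qed
      moreover have "bounded_subanalytic (m + k) ((\<Union>x\<in>I. ?v ` ?r ` W x) \<inter> ?U)"
        using I(2) I_good
        by (intro bounded_subanalytic_Int bounded_subanalytic_UN semianalytic_open_box)
          (simp_all add: good_def subanalytic_rel_def)
      moreover have "w \<in> ?U"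
        using w by (simp add: centre_in_open_box)
      ultimately show "\<exists>U. openin (Euclidean_space (m + k)) U \<and> w \<in> U \<and> bounded_subanalytic (m + k) (?\<Gamma> \<inter> U)"
        using openin_open_box by (intro exI [of _ ?U]) simp
    qed
    then show ?thesis
      unfolding subanalytic_map_def vec_Times_Euclidean_space using cont by blast
  qed
  have "(?h \<circ> \<sigma>) ` complex_space K \<subseteq> complex_space L"
    using h_in \<sigma>_image by auto
  then show ?thesis
    unfolding subanalytic_complex_map_def using main by blast
qed

end

theorem mainTheorem2:
  fixes n :: nat and X :: "'a topology" and \<OO> :: "('g, 'a) orbifold_chart set set"
    and K\<^sub>1 :: "'v set set" and \<tau>\<^sub>1 :: "('v \<Rightarrow> real) \<Rightarrow> 'a"
    and K\<^sub>2 :: "'w set set" and \<tau>\<^sub>2 :: "('w \<Rightarrow> real) \<Rightarrow> 'a"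
  assumes "real_analytic_orbifold n X \<OO>"
    and "subanalytic_triangulation n X \<OO> K\<^sub>1 \<tau>\<^sub>1"
    and "subanalytic_triangulation n X \<OO> K\<^sub>2 \<tau>\<^sub>2"
  shows "subanalytic_complex_homeomorphism K\<^sub>2 K\<^sub>1 (inv_into (complex_space K\<^sub>1) \<tau>\<^sub>1 \<circ> \<tau>\<^sub>2)"
proof -
  let ?f = "inv_into (complex_space K\<^sub>1) \<tau>\<^sub>1 \<circ> \<tau>\<^sub>2" and ?g = "inv_into (complex_space K\<^sub>2) \<tau>\<^sub>2 \<circ> \<tau>\<^sub>1"
  have homeo: "homeomorphic_map (complex_topology K\<^sub>1) X \<tau>\<^sub>1" "homeomorphic_map (complex_topology K\<^sub>2) X \<tau>\<^sub>2"
    using assms by (auto simp: subanalytic_triangulation_def)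
  have bij: "bij_betw \<tau>\<^sub>1 (complex_space K\<^sub>1) (topspace X)" "bij_betw \<tau>\<^sub>2 (complex_space K\<^sub>2) (topspace X)"
    using homeo [THEN homeomorphic_imp_injective_map] homeo [THEN homeomorphic_imp_surjective_map]
    by (auto simp: bij_betw_def topspace_complex_topology)
  have f: "bij_betw ?f (complex_space K\<^sub>2) (complex_space K\<^sub>1)"
    using bij(2) bij_betw_inv_into [OF bij(1)] by (rule bij_betw_trans)
  have "inv_into (complex_space K\<^sub>2) ?f b = ?g b" if b: "b \<in> complex_space K\<^sub>1" for b
  proof (rule inv_into_f_eq)
    show "inj_on ?f (complex_space K\<^sub>2)"
      using f by (rule bij_betw_imp_inj_on)
    have \<tau>_b: "\<tau>\<^sub>1 b \<in> topspace X"
      using bij(1) b by (rule bij_betw_apply)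
    then show "?g b \<in> complex_space K\<^sub>2"
      using bij_betw_apply [OF bij_betw_inv_into [OF bij(2)]] by simp
    show "?f (?g b) = b"
      using bij_betw_inv_into_right [OF bij(2) \<tau>_b] bij_betw_inv_into_left [OF bij(1) b] by simp
  qed
  then have "subanalytic_complex_map K\<^sub>1 K\<^sub>2 (inv_into (complex_space K\<^sub>2) ?f) \<longleftrightarrow>
      subanalytic_complex_map K\<^sub>1 K\<^sub>2 ?g"
    by (rule subanalytic_complex_map_cong)
  then show ?thesis
    unfolding subanalytic_complex_homeomorphism_def
    using f transition_subanalytic [OF assms(1,3,2)] transition_subanalytic [OF assms] by blast
qed

end
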